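(* A generic two-boson Gaussian pentachoron weight is reduced, by a gauge transformation, to a product of five delta functions of linear combinations of the variables $x_t$ and $y_t$. That is, for all complex symmetric $10\times10$ matrices $F$ in some nonempty Zariski-open set, there is an element $g\in\mathrm{Sp}(4,\mathbb C)^{\times5}$ and five linearly independent linear forms $\ell_1,\dots,\ell_5$ in the ten variables $x_t,y_t$ such that $g\,V_L(F)$ is the Lagrangian subspace of operators annihilating $\prod_{i=1}^5\delta(\ell_i)$, i.e. the span of the multiplication operators $\ell_1,\dots,\ell_5$ and of all linear combinations of the $\partial/\partial x_t,\partial/\partial y_t$ that annihilate $\ell_1,\dots,\ell_5$.
   Context: Let $u=12345$ be a pentachoron (4-simplex); its tetrahedra $t$ are the 4-element subsets of $\{1,\dots,5\}$. To each $t$ attach two complex variables $x_t,y_t$ and the 4-dimensional space of operators $V_t=\mathrm{span}_{\mathbb C}\{\partial/\partial x_t,\partial/\partial y_t,x_t,y_t\}$ ($x_t,y_t$ acting by multiplication), with symplectic product given by the commutator. Let $V_u=\bigoplus_{t\subset u}V_t$ (20-dimensional). The gauge group $\mathrm{Sp}(4,\mathbb C)^{\times5}$ acts on $V_u$, one factor on each $V_t$, and its elements are called gauge transformations. A symmetric $10\times10$ matrix $F$ (indexed by the ten variables, listed as $z_1,\dots,z_{10}$) determines the weight $\exp(-\tfrac12\sum_{p,q}F_{pq}z_pz_q)$ and the Lagrangian subspace $V_L(F)\subset V_u$ spanned by the ten operators $\partial/\partial z_p+\sum_qF_{pq}z_q$ annihilating it. Weights are considered up to a constant factor and are identified with the Lagrangian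 subspaces of operators annihilating them. *)

theory Defs
  imports "HOL-Analysis.Analysis"
begin

section \<open>Tetrahedra, variables and operators\<close>

typedef tetrahedron = "{t :: nat set. t \<subseteq> {1..5} \<and> card t = 4}"
  by (rule exI[of _ "{1..4}"]) auto

instance tetrahedron :: finite
proof
  have "finite {t :: nat set. t \<subseteq> {1..5} \<and> card t = 4}"
    by (rule finite_subset[of _ "Pow {1..5}"]) auto
  then show "finite (UNIV :: tetrahedron set)"
    by (subst type_definition.univ[OF type_definition_tetrahedron]) (rule finite_imageI)
qed

datatype coord = X | Y

instance coord :: finite
proof
  have "(UNIV :: coord set) = {X, Y}" using coord.exhaust by blast
  then show "finite (UNIV :: coord set)" by (metis finite.emptyI finite_insert)
qed

text \<open>The variable \<open>x\<^sub>t\<close> is \<open>(t, X)\<close> and \<open>y\<^sub>t\<close> is \<open>(t, Y)\<close>.\<close>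

type_synonym var = "tetrahedron \<times> coord"

text \<open>\<open>D c\<close> indexes the partial derivative in the variable \<open>c\<close> and \<open>M c\<close> the multiplication by it.\<close>

datatype gen = D coord | M coord

instance gen :: finite
proof
  have "(UNIV :: gen set) = range D \<union> range M" using gen.exhaust by blast
  then show "finite (UNIV :: gen set)" by (metis finite_Un finite_code finite_imageI)
qed

text \<open>An operator is given by its coordinates in the basis of derivatives and multiplications;
  \<open>op_apply\<close> below is the actual operator.\<close>

type_synonym vt = "complex ^ gen"
type_synonym vu = "complex ^ (tetrahedron \<times> gen)"

definition deriv_op :: "var \<Rightarrow> vu" where
  "deriv_op p = axis (fst p, D (snd p)) 1"

definition mult_op :: "var \<Rightarrow> vu" where
  "mult_op p = axis (fst p, M (snd p)) 1"

definition component :: "tetrahedron \<Rightarrow> vu \<Rightarrow> vt" where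
  "component t v = (\<chi> i. v $ (t, i))"

definition partial :: "var \<Rightarrow> (complex ^ var \<Rightarrow> complex) \<Rightarrow> complex ^ var \<Rightarrow> complex" where
  "partial p f z = deriv (\<lambda>w. f (\<chi> q. if q = p then w else z $ q)) (z $ p)"

definition op_apply :: "vu \<Rightarrow> (complex ^ var \<Rightarrow> complex) \<Rightarrow> complex ^ var \<Rightarrow> complex" where
  "op_apply v f z = (\<Sum>(t, c)\<in>UNIV. v $ (t, D c) * partial (t, c) f z + v $ (t, M c) * (z $ (t, c) * f z))"

section \<open>Symplectic product and gauge transformations\<close>

text \<open>The commutator of two elements of \<open>V\<^sub>t\<close>, see \<open>commutator_op_apply\<close>.\<close>

definition sympl :: "vt \<Rightarrow> vt \<Rightarrow> complex" where
  "sympl v w = (\<Sum>c\<in>UNIV. v $ D c * w $ M c - v $ M c * w $ D c)"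

definition Sp4 :: "(complex ^ gen ^ gen) set" where
  "Sp4 = {A. \<forall>v w. sympl (A *v v) (A *v w) = sympl v w}"

definition gauge_act :: "(tetrahedron \<Rightarrow> complex ^ gen ^ gen) \<Rightarrow> vu \<Rightarrow> vu" where
  "gauge_act g v = (\<chi> p. (g (fst p) *v component (fst p) v) $ snd p)"

section \<open>Lagrangian subspaces of the weights\<close>

definition gaussian_op :: "complex ^ var ^ var \<Rightarrow> var \<Rightarrow> vu" where
  "gaussian_op F p = deriv_op p + (\<Sum>q\<in>UNIV. F $ p $ q *s mult_op q)"

definition V_L :: "complex ^ var ^ var \<Rightarrow> vu set" where
  "V_L F = vec.span (range (gaussian_op F))"

text \<open>A linear form is given by its coefficients.\<close>

definition form_op :: "complex ^ var \<Rightarrow> vu" where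
  "form_op l = (\<Sum>p\<in>UNIV. l $ p *s mult_op p)"

definition derivation_op :: "complex ^ var \<Rightarrow> vu" where
  "derivation_op a = (\<Sum>p\<in>UNIV. a $ p *s deriv_op p)"

text \<open>The operators annihilating the product of the \<open>\<delta>(l i)\<close>, \<open>i \<in> I\<close>. The sum is the
  value of \<open>derivation_op a\<close> on the form \<open>l i\<close>, see \<open>op_apply_derivation_form\<close>.\<close>

definition V_delta :: "'i set \<Rightarrow> ('i \<Rightarrow> complex ^ var) \<Rightarrow> vu set" where
  "V_delta I l = vec.span (form_op ` l ` I \<union>
     {derivation_op a | a. \<forall>i\<in>I. (\<Sum>p\<in>UNIV. a $ p * l i $ p) = 0})"

section \<open>Polynomial functions and Zariski-open sets\<close>

inductive_set poly_funs :: "('a \<Rightarrow> complex) set \<Rightarrow> ('a \<Rightarrow> complex) set"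
  for C :: "('a \<Rightarrow> complex) set" where
  coord: "f \<in> C \<Longrightarrow> f \<in> poly_funs C"
| const: "(\<lambda>_. c) \<in> poly_funs C"
| add: "f \<in> poly_funs C \<Longrightarrow> g \<in> poly_funs C \<Longrightarrow> (\<lambda>x. f x + g x) \<in> poly_funs C"
| mult: "f \<in> poly_funs C \<Longrightarrow> g \<in> poly_funs C \<Longrightarrow> (\<lambda>x. f x * g x) \<in> poly_funs C"

definition sym_matrices :: "(complex ^ 'n ^ 'n) set" where
  "sym_matrices = {F. transpose F = F}"

definition zariski_open_sym :: "(complex ^ 'n ^ 'n) set \<Rightarrow> bool" where
  "zariski_open_sym U \<longleftrightarrow> (\<exists>P \<subseteq> poly_funs (range (\<lambda>(i, j) F. F $ i $ j)).
     U = sym_matrices - {F. \<forall>p\<in>P. p F = 0})"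

section \<open>The operators behind the coordinates\<close>

abbreviation polys :: "(complex ^ var \<Rightarrow> complex) set" where
  "polys \<equiv> poly_funs (range (\<lambda>p z. z $ p))"

lemma upd_same: "(\<chi> q. if q = p then z $ p else z $ q) = z"
  by (simp add: vec_eq_iff)

lemma poly_fun_differentiable:
  assumes "f \<in> polys"
  shows "(\<lambda>w. f (\<chi> q. if q = p then w else z $ q)) field_differentiable (at x)"
  using assms
proof induction
  case (coord f)
  then obtain r where "f = (\<lambda>z. z $ r)" by auto
  then show ?case by (cases "r = p") auto
qed (auto intro: field_differentiable_add field_differentiable_mult)

lemma partial_const: "partial p (\<lambda>_. c) = (\<lambda>_. 0)"
  by (simp add: partial_def fun_eq_iff)

lemma partial_coord: "partial p (\<lambda>z. z $ r) = (\<lambda>_. if r = p then 1 else 0)"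
  by (cases "r = p") (simp_all add: partial_def fun_eq_iff)

lemma partial_add:
  assumes "f \<in> polys" "g \<in> polys"
  shows "partial p (\<lambda>z. f z + g z) = (\<lambda>z. partial p f z + partial p g z)"
  using poly_fun_differentiable[OF assms(1)] poly_fun_differentiable[OF assms(2)]
  by (simp add: partial_def fun_eq_iff)

lemma partial_mult:
  assumes "f \<in> polys" "g \<in> polys"
  shows "partial p (\<lambda>z. f z * g z) = (\<lambda>z. f z * partial p g z + partial p f z * g z)"
  using poly_fun_differentiable[OF assms(1)] poly_fun_differentiable[OF assms(2)]
  by (simp add: partial_def fun_eq_iff upd_same)

lemma partial_poly: "f \<in> polys \<Longrightarrow> partial p f \<in> polys"
proof (induction rule: poly_funs.induct)
  case (coord f)
  then show ?case by (auto simp: partial_coord intro: poly_funs.const)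
qed (auto simp: partial_const partial_add partial_mult intro: poly_funs.intros)

lemma partial_commute: "f \<in> polys \<Longrightarrow> partial p (partial q f) = partial q (partial p f)"
proof (induction rule: poly_funs.induct)
  case (coord f)
  then show ?case by (auto simp: partial_coord partial_const)
next
  case (mult f g)
  then show ?case
    by (simp add: partial_mult partial_add partial_poly poly_funs.mult algebra_simps)
qed (auto simp: partial_const partial_add partial_poly)

lemma sum_polys: "finite A \<Longrightarrow> (\<And>p. p \<in> A \<Longrightarrow> h p \<in> polys) \<Longrightarrow> (\<lambda>z. \<Sum>p\<in>A. h p z) \<in> polys"
  by (induction rule: finite_induct) (auto intro: poly_funs.intros)

lemma partial_sum:
  "finite A \<Longrightarrow> (\<And>p. p \<in> A \<Longrightarrow> h p \<in> polys) \<Longrightarrow>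
    partial q (\<lambda>z. \<Sum>p\<in>A. h p z) = (\<lambda>z. \<Sum>p\<in>A. partial q (h p) z)"
  by (induction rule: finite_induct) (simp_all add: partial_const partial_add sum_polys)

lemma coord_poly: "(\<lambda>z. z $ p) \<in> polys"
  by (rule poly_funs.coord) auto

lemma op_apply_alt:
  "op_apply v f = (\<lambda>z. \<Sum>p\<in>UNIV. v $ (fst p, D (snd p)) * partial p f z
     + v $ (fst p, M (snd p)) * (z $ p * f z))"
  by (simp add: op_apply_def case_prod_unfold fun_eq_iff)

lemma op_apply_poly: "f \<in> polys \<Longrightarrow> op_apply v f \<in> polys"
  unfolding op_apply_alt
  by (intro sum_polys finite poly_funs.add poly_funs.mult poly_funs.const coord_poly partial_poly)

lemma sum_sympl:
  "(\<Sum>t\<in>UNIV. sympl (component t v) (component t w)) =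
   (\<Sum>p\<in>UNIV. v $ (fst p, D (snd p)) * w $ (fst p, M (snd p))
     - v $ (fst p, M (snd p)) * w $ (fst p, D (snd p)))"
  by (simp add: sympl_def component_def sum.cartesian_product case_prod_unfold flip: UNIV_Times_UNIV)

lemma op_apply_twice:
  fixes v w :: vu
  defines "a \<equiv> \<lambda>p. v $ (fst p, D (snd p))" and "b \<equiv> \<lambda>p. v $ (fst p, M (snd p))"
    and "a' \<equiv> \<lambda>p. w $ (fst p, D (snd p))" and "b' \<equiv> \<lambda>p. w $ (fst p, M (snd p))"
  assumes f: "f \<in> polys"
  shows "op_apply v (op_apply w f) z =
    (\<Sum>q\<in>UNIV. \<Sum>p\<in>UNIV. a q * a' p * partial q (partial p f) z + a q * b' p * z $ p * partial q f z
        + b q * a' p * z $ q * partial p f z + b q * b' p * z $ q * z $ p * f z)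
    + (\<Sum>q\<in>UNIV. a q * b' q) * f z"
proof -
  have w: "op_apply w f = (\<lambda>z. \<Sum>p\<in>UNIV. a' p * partial p f z + b' p * (z $ p * f z))"
    by (simp add: op_apply_alt a'_def b'_def)
  have "partial q (\<lambda>z. a' p * partial p f z + b' p * (z $ p * f z)) =
      (\<lambda>z. a' p * partial q (partial p f) z + b' p * (z $ p * partial q f z + (if p = q then f z else 0)))"
    for p q
    using f by (simp add: partial_add partial_mult partial_const partial_coord partial_poly
        poly_funs.mult poly_funs.const coord_poly)
  then have pw: "partial q (op_apply w f) =
      (\<lambda>z. \<Sum>p\<in>UNIV. a' p * partial q (partial p f) z
        + b' p * (z $ p * partial q f z + (if p = q then f z else 0)))" for q
    unfolding w using f
    by (subst partial_sum) (auto intro!: poly_funs.add poly_funs.mult poly_funs.const coord_poly partial_poly)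
  have e: "a q * (\<Sum>p\<in>UNIV. a' p * partial q (partial p f) z
        + b' p * (z $ p * partial q f z + (if p = q then f z else 0))) =
     (\<Sum>p\<in>UNIV. a q * a' p * partial q (partial p f) z + a q * b' p * z $ p * partial q f z)
       + a q * b' q * f z" for q
    by (simp add: sum_distrib_left distrib_left sum.distrib if_distrib[of "\<lambda>x. _ * x"] mult.assoc
        cong: if_cong)
  have "op_apply v (op_apply w f) z =
      (\<Sum>q\<in>UNIV. a q * partial q (op_apply w f) z + b q * (z $ q * op_apply w f z))"
    by (simp add: op_apply_alt[of v] a_def b_def)
  then show ?thesis
    unfolding pw e unfolding w
    by (simp add: sum.distrib sum_distrib_left sum_distrib_right distrib_left mult_ac)
qed

lemma commutator_op_apply:
  assumes f: "f \<in> polys"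
  shows "op_apply v (op_apply w f) z - op_apply w (op_apply v f) z =
    (\<Sum>t\<in>UNIV. sympl (component t v) (component t w)) * f z"
proof -
  define a b a' b' where "a = (\<lambda>p. v $ (fst p, D (snd p)))" and "b = (\<lambda>p. v $ (fst p, M (snd p)))"
    and "a' = (\<lambda>p. w $ (fst p, D (snd p)))" and "b' = (\<lambda>p. w $ (fst p, M (snd p)))"
  have "(\<Sum>q\<in>UNIV. \<Sum>p\<in>UNIV. a q * a' p * partial q (partial p f) z + a q * b' p * z $ p * partial q f z
        + b q * a' p * z $ q * partial p f z + b q * b' p * z $ q * z $ p * f z) =
      (\<Sum>q\<in>UNIV. \<Sum>p\<in>UNIV. a' q * a p * partial q (partial p f) z + a' q * b p * z $ p * partial q f z
        + b' q * a p * z $ q * partial p f z + b' q * b p * z $ q * z $ p * f z)"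
    by (subst sum.swap, intro sum.cong refl) (subst partial_commute[OF f], simp add: algebra_simps)
  then show ?thesis
    by (simp add: op_apply_twice[OF f] sum_sympl sum_subtractf algebra_simps
        a_def b_def a'_def b'_def)
qed

lemma basis_op_nth [simp]:
  "deriv_op p $ (t, D c) = (if p = (t, c) then 1 else 0)" "deriv_op p $ (t, M c) = 0"
  "mult_op p $ (t, D c) = 0" "mult_op p $ (t, M c) = (if p = (t, c) then 1 else 0)"
  by (cases p; auto simp: deriv_op_def mult_op_def axis_def)+

lemma gaussian_op_nth [simp]:
  "gaussian_op F p $ (t, D c) = (if p = (t, c) then 1 else 0)"
  "gaussian_op F p $ (t, M c) = F $ p $ (t, c)"
  by (simp_all add: gaussian_op_def if_distrib[of "\<lambda>x. _ * x"] cong: if_cong)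

lemma has_field_derivative_upd:
  "((\<lambda>w. (\<chi> q. if q = p then w else z $ q) $ r) has_field_derivative (if r = p then 1 else 0)) (at x)"
  by (cases "r = p") (auto intro!: derivative_eq_intros)

text \<open>The ten operators spanning \<open>V_L F\<close> annihilate the Gaussian weight.\<close>

lemma op_apply_gaussian:
  assumes "F \<in> sym_matrices"
  shows "op_apply (gaussian_op F r)
    (\<lambda>z. exp (- (\<Sum>p\<in>UNIV. \<Sum>q\<in>UNIV. F $ p $ q * z $ p * z $ q) / 2)) = (\<lambda>_. 0)"
proof
  fix z :: "complex ^ var"
  define E where "E = (\<lambda>z :: complex ^ var. exp (- (\<Sum>p\<in>UNIV. \<Sum>q\<in>UNIV. F $ p $ q * z $ p * z $ q) / 2))"
  have F: "F $ p $ q = F $ q $ p" for p q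
    using assms by (cases p, cases q) (auto simp: sym_matrices_def transpose_def vec_eq_iff)
  let ?d = "\<lambda>p. if p = r then 1 else 0 :: complex"
  let ?u = "\<lambda>w. (\<chi> q. if q = r then w else z $ q)"
  have "((\<lambda>w. F $ p $ q * ?u w $ p * ?u w $ q) has_field_derivative
      F $ p $ q * ?d p * z $ q + F $ p $ q * z $ p * ?d q) (at (z $ r))" for p q
    using DERIV_mult[OF DERIV_cmult[OF has_field_derivative_upd[of r z p "z $ r"], of "F $ p $ q"]
        has_field_derivative_upd[of r z q "z $ r"]]
    unfolding upd_same by (simp only: mult_ac add_ac)
  then have "((\<lambda>w. \<Sum>p\<in>UNIV. \<Sum>q\<in>UNIV. F $ p $ q * ?u w $ p * ?u w $ q) has_field_derivative
      (\<Sum>p\<in>UNIV. \<Sum>q\<in>UNIV. F $ p $ q * ?d p * z $ q + F $ p $ q * z $ p * ?d q)) (at (z $ r))"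
    by (intro DERIV_sum)
  from DERIV_fun_exp[OF DERIV_cdivide[OF DERIV_minus[OF this], of 2]]
  have "((\<lambda>w. E (?u w)) has_field_derivative
     E z * (- (\<Sum>p\<in>UNIV. \<Sum>q\<in>UNIV. F $ p $ q * ?d p * z $ q + F $ p $ q * z $ p * ?d q) / 2)) (at (z $ r))"
    unfolding E_def upd_same .
  moreover have "(\<Sum>p\<in>UNIV. \<Sum>q\<in>UNIV. F $ p $ q * ?d p * z $ q + F $ p $ q * z $ p * ?d q) =
      2 * (\<Sum>q\<in>UNIV. F $ r $ q * z $ q)"
  proof -
    have "(\<Sum>p\<in>UNIV. \<Sum>q\<in>UNIV. F $ p $ q * ?d p * z $ q) = (\<Sum>q\<in>UNIV. F $ r $ q * z $ q)"
      by (subst sum.swap) (simp add: if_distrib[of "\<lambda>x. _ * x * _"] cong: if_cong)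
    moreover have "(\<Sum>p\<in>UNIV. \<Sum>q\<in>UNIV. F $ p $ q * z $ p * ?d q) = (\<Sum>q\<in>UNIV. F $ r $ q * z $ q)"
      by (simp add: if_distrib[of "\<lambda>x. _ * x"] cong: if_cong) (intro sum.cong refl, subst F, rule refl)
    ultimately show ?thesis by (simp add: sum.distrib)
  qed
  ultimately have "partial r E z = - E z * (\<Sum>q\<in>UNIV. F $ r $ q * z $ q)"
    unfolding partial_def by (intro DERIV_imp_deriv) simp
  moreover have "op_apply (gaussian_op F r) E z =
      (\<Sum>q\<in>UNIV. if r = q then partial q E z else 0) + (\<Sum>q\<in>UNIV. F $ r $ q * (z $ q * E z))"
    unfolding op_apply_alt gaussian_op_nth prod.collapse sum.distrib[symmetric]
    by (intro sum.cong refl) simp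
  ultimately have "op_apply (gaussian_op F r) E z = 0"
    by (simp flip: mult.assoc sum_distrib_right)
  then show "op_apply (gaussian_op F r)
    (\<lambda>z. exp (- (\<Sum>p\<in>UNIV. \<Sum>q\<in>UNIV. F $ p $ q * z $ p * z $ q) / 2)) z = 0"
    by (simp add: E_def)
qed

lemma derivation_form_op_nth [simp]:
  "derivation_op a $ (t, D c) = a $ (t, c)" "derivation_op a $ (t, M c) = 0"
  "form_op l $ (t, D c) = 0" "form_op l $ (t, M c) = l $ (t, c)"
  by (simp_all add: derivation_op_def form_op_def if_distrib[of "\<lambda>x. _ * x"] cong: if_cong)

lemma op_apply_derivation_form:
  "op_apply (derivation_op a) (\<lambda>z. \<Sum>p\<in>UNIV. l $ p * z $ p) = (\<lambda>_. \<Sum>p\<in>UNIV. a $ p * l $ p)"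
proof -
  have "partial q (\<lambda>z. \<Sum>p\<in>UNIV. l $ p * z $ p) = (\<lambda>_. l $ q)" for q
    by (subst partial_sum)
      (simp_all add: poly_funs.mult poly_funs.const coord_poly partial_mult partial_const partial_coord
        if_distrib[of "\<lambda>x. _ * x"] cong: if_cong)
  then show ?thesis by (simp add: op_apply_def case_prod_unfold fun_eq_iff)
qed

lemma op_apply_form_op:
  "op_apply (form_op l) f z = (\<Sum>p\<in>UNIV. l $ p * z $ p) * f z"
  by (simp add: op_apply_def case_prod_unfold sum_distrib_right mult.assoc)

end

theory Submission
  imports Defs
begin

text \<open>A decomposition of each \<open>V\<^sub>t\<close> into two transverse Lagrangian planes is the same as an element \<open>J\<^sub>t\<close>
  of \<open>sp(4)\<close> with \<open>J\<^sub>t\<^sup>2 = 1\<close>, and a weight is gauge equivalent to a product of five delta functions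
  iff its Lagrangian subspace is stable under such a \<open>J\<close> and \<open>J\<close> has trace 0 on it. Stability is
  a linear system \<open>stab F J = 0\<close> whose coefficients are polynomials in \<open>F\<close>. At a suitable \<open>F0\<close>,
  built from the adjacency matrix of the pentagon, its solution space is a line, so Cramer's rule
  gives a polynomial vector \<open>\<xi> F\<close> that spans it wherever it is nonzero and \<open>F\<close> is generic.

  All symmetric \<open>F\<close> near \<open>F0\<close> are of the form \<open>s + w N w\<^sup>T\<close> with \<open>s\<close> block diagonal and
  \<open>w\<^sup>T k w = N\<^sup>-\<^sup>1\<close> for a block diagonal \<open>k\<close>, because the derivative of this family is surjective at
  \<open>F0\<close>; such \<open>F\<close> are reducible, with an explicit \<open>J\<close>. Hence the polynomial identities saying that
  \<open>\<xi> F\<close> solves the system, has scalar square and trace 0 hold near \<open>F0\<close> and therefore everywhere,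
  and where the scalar \<open>c F\<close> does not vanish, \<open>\<xi> F / \<surd>(c F)\<close> is the required \<open>J\<close>.\<close>

section \<open>Matrix algebra\<close>

lemma matrix_add_rdistrib: "(A + B) ** C = A ** C + B ** C"
  by (simp add: matrix_matrix_mult_def vec_eq_iff distrib_right sum.distrib)

lemma matrix_diff_ldistrib: "A ** (B - C) = A ** B - A ** (C :: 'a::ring_1 ^ 'n ^ 'm)"
  by (simp add: matrix_matrix_mult_def vec_eq_iff right_diff_distrib sum_subtractf)

lemma matrix_diff_rdistrib: "(A - B) ** C = A ** C - B ** (C :: 'a::ring_1 ^ 'n ^ 'm)"
  by (simp add: matrix_matrix_mult_def vec_eq_iff left_diff_distrib sum_subtractf)

lemma matrix_minus_mul: "(- A) ** B = - (A ** (B :: 'a::ring_1 ^ 'n ^ 'm))"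
  by (simp add: matrix_matrix_mult_def vec_eq_iff sum_negf)

lemma matrix_mul_minus: "A ** (- B) = - (A ** (B :: 'a::ring_1 ^ 'n ^ 'm))"
  by (simp add: matrix_matrix_mult_def vec_eq_iff sum_negf)

lemma transpose_add: "transpose (A + B) = transpose A + transpose B"
  by (simp add: transpose_def vec_eq_iff)

lemma transpose_diff: "transpose (A - B) = transpose A - transpose B"
  by (simp add: transpose_def vec_eq_iff)

lemma transpose_minus: "transpose (- A) = - transpose A"
  by (simp add: transpose_def vec_eq_iff)

lemma transpose_0: "transpose 0 = 0"
  by (simp add: transpose_def vec_eq_iff)

lemmas mat_ring = matrix_add_ldistrib matrix_add_rdistrib matrix_diff_ldistrib matrix_diff_rdistrib
  matrix_minus_mul matrix_mul_minus matrix_mul_assoc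

lemmas transpose_simps = transpose_add transpose_diff transpose_minus matrix_transpose_mul transpose_0

lemma trace_mul_commute:
  fixes A :: "'a::comm_semiring_1 ^ 'n ^ 'm"
  shows "trace (A ** B) = trace (B ** A)"
  by (simp add: trace_def matrix_matrix_mult_def mult.commute) (rule sum.swap)

text \<open>\<open>E\<close> fixes its range pointwise, so in a basis of the range each basis vector
  contributes its own coordinate, which is 1, to the trace. The basis is exported because it becomes
  the five linear forms.\<close>

lemma trace_idempotent:
  fixes E :: "'a::field ^ 'n ^ 'n"
  assumes idem: "E ** E = E"
  obtains B where "B \<subseteq> range ((*v) E)" "vec.independent B" "vec.span B = range ((*v) E)"
    "trace E = of_nat (card B)"
proof -
  obtain B where B: "B \<subseteq> range ((*v) E)" "vec.independent B" "range ((*v) E) \<subseteq> vec.span B"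
    by (meson vec.basis_exists)
  have sub: "vec.subspace (range ((*v) E))"
    using vec.linear_subspace_image[OF matrix_vector_mul_linear_gen vec.subspace_UNIV] .
  have span: "vec.span B = range ((*v) E)"
    using B sub by (simp add: subset_antisym vec.span_minimal)
  have fin: "finite B"
    by (rule vec.finiteI_independent[OF B(2)])
  define r where "r b x = vec.representation B (E *v x) b" for b x
  have EB: "E *v b = b" if "b \<in> B" for b
    using B(1) that idem by (auto simp: matrix_vector_mul_assoc)
  have lin: "Vector_Spaces.linear (*s) (*) (r b)" for b
  proof (unfold_locales)
    fix x y c
    show "r b (x + y) = r b x + r b y"
      unfolding r_def matrix_vector_right_distrib
      by (subst vec.representation_add[OF B(2)]) (auto simp: span)
    show "r b (c *s x) = c * r b x"
      unfolding r_def vector_scalar_commute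
      by (subst vec.representation_scale[OF B(2)]) (auto simp: span)
  qed
  interpret r: Vector_Spaces.linear "(*s)" "(*)" "r b" for b
    by (rule lin)
  have Ex: "E *v x = (\<Sum>b\<in>B. r b x *s b)" for x
    unfolding r_def
    by (rule vec.sum_representation_eq[symmetric, OF B(2) _ fin]) (auto simp: span)
  have rb: "r b b = 1" if "b \<in> B" for b
    using that B(2) by (simp add: r_def EB vec.representation_basis)
  have col: "E $ p $ p = (\<Sum>b\<in>B. r b (axis p 1) * b $ p)" for p
  proof -
    have "E $ p $ p = (E *v axis p 1) $ p"
      by (simp add: matrix_vector_mult_def axis_def if_distrib[of "\<lambda>x. _ * x"] cong: if_cong)
    also have "\<dots> = (\<Sum>b\<in>B. r b (axis p 1) * b $ p)"
      by (simp add: Ex)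
    finally show ?thesis .
  qed
  have "trace E = (\<Sum>b\<in>B. \<Sum>p\<in>UNIV. r b (axis p 1) * b $ p)"
    unfolding trace_def col by (rule sum.swap)
  also have "\<dots> = (\<Sum>b\<in>B. r b b)"
  proof (rule sum.cong[OF refl])
    fix b
    have "r b b = r b (\<Sum>p\<in>UNIV. b $ p *s axis p 1)"
      by (simp add: basis_expansion)
    also have "\<dots> = (\<Sum>p\<in>UNIV. b $ p * r b (axis p 1))"
      by (simp add: r.sum r.scale)
    finally show "(\<Sum>p\<in>UNIV. r b (axis p 1) * b $ p) = r b b"
      by (simp add: mult.commute)
  qed
  also have "\<dots> = of_nat (card B)"
    by (simp add: rb)
  finally show ?thesis
    using that B(1,2) span by blast
qed

section \<open>Polynomial functions of a matrix\<close>

abbreviation mpolys :: "(complex ^ 'n ^ 'm \<Rightarrow> complex) set" where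
  "mpolys \<equiv> poly_funs (range (\<lambda>(i, j) F. F $ i $ j))"

lemma poly_funs_sum:
  "finite A \<Longrightarrow> (\<And>p. p \<in> A \<Longrightarrow> h p \<in> poly_funs C) \<Longrightarrow> (\<lambda>z. \<Sum>p\<in>A. h p z) \<in> poly_funs C"
  by (induction rule: finite_induct) (auto intro: poly_funs.intros)

lemma poly_funs_prod:
  "finite A \<Longrightarrow> (\<And>p. p \<in> A \<Longrightarrow> h p \<in> poly_funs C) \<Longrightarrow> (\<lambda>z. \<Prod>p\<in>A. h p z) \<in> poly_funs C"
  by (induction rule: finite_induct) (auto intro: poly_funs.intros)

lemma poly_funs_uminus: "f \<in> poly_funs C \<Longrightarrow> (\<lambda>z. - f z) \<in> poly_funs C"
  using poly_funs.mult[OF poly_funs.const[of "-1"]] by fastforce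

lemma poly_funs_diff: "f \<in> poly_funs C \<Longrightarrow> g \<in> poly_funs C \<Longrightarrow> (\<lambda>z. f z - g z) \<in> poly_funs C"
  using poly_funs.add[OF _ poly_funs_uminus] by fastforce

lemma poly_funs_if: "f \<in> poly_funs C \<Longrightarrow> g \<in> poly_funs C \<Longrightarrow> (\<lambda>z. if b then f z else g z) \<in> poly_funs C"
  by (cases b) auto

lemma poly_funs_det:
  assumes "\<And>i j. (\<lambda>z. A z $ i $ j) \<in> poly_funs C"
  shows "(\<lambda>z. det (A z)) \<in> poly_funs C"
  unfolding det_def
  by (intro poly_funs_sum poly_funs_prod poly_funs.mult poly_funs.const assms finite_permutations finite)

lemma poly_funs_matrix_mul:
  assumes "\<And>i j. (\<lambda>z. A z $ i $ j) \<in> poly_funs C" "\<And>i j. (\<lambda>z. B z $ i $ j) \<in> poly_funs C"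
  shows "(\<lambda>z. (A z ** B z) $ i $ j) \<in> poly_funs C"
  unfolding matrix_matrix_mult_def by (simp add: poly_funs_sum poly_funs.mult assms)

lemma mpolys_coord: "(\<lambda>F. F $ i $ j) \<in> mpolys"
  by (rule poly_funs.coord) auto

text \<open>Restriction to a line reduces the identity theorem to counting roots of a univariate
  polynomial.\<close>

lemma mpolys_on_line:
  assumes "f \<in> mpolys"
  shows "\<exists>q. \<forall>t. f (\<chi> i j. F $ i $ j + t * H $ i $ j) = poly q t"
  using assms
proof induction
  case (coord f)
  then obtain i j where "f = (\<lambda>F. F $ i $ j)" by auto
  then show ?case by (intro exI[of _ "[:F $ i $ j, H $ i $ j:]"]) simp
next
  case (const c)
  then show ?case by (intro exI[of _ "[:c:]"]) simp
next
  case (add f g)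
  then obtain p q where "\<forall>t. f (\<chi> i j. F $ i $ j + t * H $ i $ j) = poly p t"
    "\<forall>t. g (\<chi> i j. F $ i $ j + t * H $ i $ j) = poly q t" by auto
  then show ?case by (intro exI[of _ "p + q"]) simp
next
  case (mult f g)
  then obtain p q where "\<forall>t. f (\<chi> i j. F $ i $ j + t * H $ i $ j) = poly p t"
    "\<forall>t. g (\<chi> i j. F $ i $ j + t * H $ i $ j) = poly q t" by auto
  then show ?case by (intro exI[of _ "p * q"]) simp
qed

text \<open>On the line from \<open>F0\<close> to \<open>F\<close> the function is a polynomial in
  one variable with a whole real interval of roots, hence zero, in particular at
  \<open>t = 1\<close>.\<close>

lemma mpolys_identity:
  assumes f: "f \<in> mpolys" and e: "e > 0" and F0: "F0 \<in> sym_matrices"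
    and zero: "\<And>F. F \<in> sym_matrices \<Longrightarrow> dist F F0 < e \<Longrightarrow> f F = 0" and F: "F \<in> sym_matrices"
  shows "f F = 0"
proof -
  define H where "H = F - F0"
  define \<phi> where "\<phi> t = (\<chi> i j. F0 $ i $ j + t * H $ i $ j)" for t
  obtain q where q: "f (\<phi> t) = poly q t" for t
    using mpolys_on_line[OF f] unfolding \<phi>_def by blast
  have real: "\<phi> (complex_of_real s) = F0 + s *\<^sub>R H" for s
    by (simp add: \<phi>_def vec_eq_iff scaleR_conv_of_real[where 'a=complex])
  \<comment> \<open>The summand 1 keeps the divisor of \<open>e\<close> positive even for
    \<open>H = 0\<close>, where the quotient would be 0.\<close>
  have root: "poly q (of_real s) = 0" if "0 < s" "s * (norm H + 1) < e" for s
  proof -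
    have "F0 + s *\<^sub>R H \<in> sym_matrices"
      using F F0 by (auto simp: H_def sym_matrices_def transpose_def vec_eq_iff)
    moreover have "dist (F0 + s *\<^sub>R H) F0 < e"
      using that by (simp add: dist_norm algebra_simps)
    ultimately show ?thesis
      using zero real q by metis
  qed
  have "q = 0"
  proof (rule ccontr)
    assume "q \<noteq> 0"
    then have "finite {x. poly q x = 0}" by (rule poly_roots_finite)
    moreover have "of_real ` {0<..<e / (norm H + 1)} \<subseteq> {x. poly q x = 0}"
      using root by (auto simp: pos_less_divide_eq add_nonneg_pos)
    moreover have "infinite (of_real ` {0<..<e / (norm H + 1)} :: complex set)"
      using e by (subst finite_image_iff) (auto simp: inj_on_def add_nonneg_pos)
    ultimately show False
      using finite_subset by blast
  qed
  then have "f (\<phi> 1) = 0" by (simp add: q)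
  moreover have "\<phi> 1 = F" by (simp add: \<phi>_def H_def vec_eq_iff)
  ultimately show ?thesis by simp
qed

text \<open>If \<open>A F0\<close> is injective, it has a left inverse \<open>N\<close>, and Cramer's rule for the square
  matrix \<open>N ** A F\<close> solves the overdetermined system for generic \<open>F\<close>.\<close>

lemma generic_cramer:
  fixes A :: "'f \<Rightarrow> complex ^ 'n ^ 'e" and b :: "complex ^ 'e"
  assumes A: "\<And>i j. (\<lambda>F. A F $ i $ j) \<in> poly_funs C"
    and inj: "\<And>x. A F0 *v x = 0 \<Longrightarrow> x = 0"
  obtains \<xi> :: "'f \<Rightarrow> complex ^ 'n" and \<delta>
  where "\<And>i. (\<lambda>F. \<xi> F $ i) \<in> poly_funs C" "\<delta> \<in> poly_funs C" "\<delta> F0 \<noteq> 0"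
    "\<And>F x c. A F *v x = c *s b \<Longrightarrow> \<delta> F *s x = c *s \<xi> F"
proof -
  obtain N :: "complex ^ 'e ^ 'n" where N: "N ** A F0 = mat 1"
    using inj matrix_left_invertible_ker by blast
  define S where "S F = N ** A F" for F
  define e where "e = N *v b"
  define R where "R F k = (\<chi> i j. if j = k then e $ i else S F $ i $ j)" for F k
  define \<xi> where "\<xi> F = (\<chi> k. det (R F k))" for F
  have S: "(\<lambda>F. S F $ i $ j) \<in> poly_funs C" for i j
    unfolding S_def by (intro poly_funs_matrix_mul A poly_funs.const)
  have "(\<lambda>F. R F k $ i $ j) \<in> poly_funs C" for i j k
    by (simp add: R_def S poly_funs_if poly_funs.const)
  then have \<xi>: "(\<lambda>F. \<xi> F $ k) \<in> poly_funs C" for k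
    by (simp add: \<xi>_def poly_funs_det)
  have sol: "det (S F) *s x = c *s \<xi> F" if "A F *v x = c *s b" for F x c
  proof (cases "det (S F) = 0 \<and> c = 0")
    case False
    have Sx: "S F *v x = c *s e"
      by (simp add: S_def e_def that vector_scalar_commute flip: matrix_vector_mul_assoc)
    have "det (S F) * x $ k = c * \<xi> F $ k" for k
    proof -
      have "(\<chi> i j. if j = k then (S F *v x) $ i else S F $ i $ j) =
          (\<chi> i j. if j = k then c * e $ i else S F $ i $ j)"
        unfolding Sx vector_smult_component by (rule refl)
      then have "x $ k * det (S F) = det (\<chi> i j. if j = k then c * e $ i else S F $ i $ j)"
        using cramer_lemma[of k "S F" x] by simp
      \<comment> \<open>Cramer's lemma replaces a column, while the scalar \<open>c\<close> is
        pulled out of a row.\<close>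
      also have "\<dots> = det (transpose (\<chi> i j. if j = k then c * e $ i else S F $ i $ j))"
        by (rule det_transpose[symmetric])
      also have "\<dots> = det (\<chi> j. if j = k then c *s e else transpose (S F) $ j)"
        by (intro arg_cong[of _ _ det]) (auto simp: vec_eq_iff transpose_def)
      also have "\<dots> = c * det (\<chi> j. if j = k then e else transpose (S F) $ j)"
        by (rule det_row_mul)
      also have "(\<chi> j. if j = k then e else transpose (S F) $ j) = transpose (R F k)"
        by (auto simp: vec_eq_iff transpose_def R_def)
      finally show ?thesis by (simp add: \<xi>_def det_transpose mult.commute)
    qed
    then show ?thesis by (simp add: vec_eq_iff)
  qed auto
  \<comment> \<open>At \<open>F0\<close> the square matrix is the identity, so its determinant is
    1.\<close>
  show ?thesis
    by (rule that[of \<xi> "\<lambda>F. det (S F)"]) (simp_all add: \<xi> sol poly_funs_det S, simp add: S_def N)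
qed

section \<open>The pentagon\<close>

text \<open>Any enumeration of the five tetrahedra gives a cyclic shift; the pentagon is an
  arbitrary choice.\<close>

lemma tetrahedron_cycle:
  obtains \<sigma> :: "tetrahedron \<Rightarrow> tetrahedron"
  where "\<And>i. \<sigma> (\<sigma> (\<sigma> (\<sigma> (\<sigma> i)))) = i"
    "\<And>i. distinct [i, \<sigma> i, \<sigma> (\<sigma> i), \<sigma> (\<sigma> (\<sigma> i)), \<sigma> (\<sigma> (\<sigma> (\<sigma> i)))]"
    "\<And>i j. j \<in> {i, \<sigma> i, \<sigma> (\<sigma> i), \<sigma> (\<sigma> (\<sigma> i)), \<sigma> (\<sigma> (\<sigma> (\<sigma> i)))}"
proof -
  have "card (UNIV :: tetrahedron set) = card {t :: nat set. t \<subseteq> {1..5} \<and> card t = 4}"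
    by (rule type_definition.card[OF type_definition_tetrahedron])
  also have "\<dots> = 5 choose 4"
    using n_subsets[of "{1..5::nat}" 4] by simp
  finally have "card (UNIV :: tetrahedron set) = 5"
    by (simp add: numeral_eq_Suc)
  then obtain h where h: "bij_betw h {0..<5::nat} (UNIV :: tetrahedron set)"
    using ex_bij_betw_nat_finite[of "UNIV :: tetrahedron set"] by auto
  define h' where "h' = the_inv_into {0..<5} h"
  define \<sigma> where "\<sigma> i = h ((h' i + 1) mod 5)" for i
  have hh': "h (h' i) = i" and h'5: "h' i < 5" for i
    using h f_the_inv_into_f_bij_betw[OF h] the_inv_into_into[of h "{0..<5}" i "{0..<5}"]
    by (auto simp: h'_def bij_betw_def)
  have h'h: "h' (h n) = n" if "n < 5" for n
    using h that by (simp add: h'_def bij_betw_def the_inv_into_f_f)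
  have h'\<sigma>: "h' (\<sigma> i) = (h' i + 1) mod 5" for i
    by (simp add: \<sigma>_def h'h)
  have eq: "i = j \<longleftrightarrow> h' i = h' j" for i j
    by (metis hh')
  have cases5: "P n" if "n < 5" "P 0" "P 1" "P 2" "P 3" "P 4" for n :: nat and P
  proof -
    have "n = 0 \<or> n = 1 \<or> n = 2 \<or> n = 3 \<or> n = 4" using that(1) by linarith
    then show ?thesis using that(2-) by auto
  qed
  show ?thesis
  proof (rule that[of \<sigma>])
    fix i j
    show "\<sigma> (\<sigma> (\<sigma> (\<sigma> (\<sigma> i)))) = i"
      unfolding eq h'\<sigma> by (rule cases5[OF h'5[of i]]) simp_all
    show "distinct [i, \<sigma> i, \<sigma> (\<sigma> i), \<sigma> (\<sigma> (\<sigma> i)), \<sigma> (\<sigma> (\<sigma> (\<sigma> i)))]"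
      unfolding distinct.simps list.set insert_iff eq h'\<sigma> by (rule cases5[OF h'5[of i]]) simp_all
    show "j \<in> {i, \<sigma> i, \<sigma> (\<sigma> i), \<sigma> (\<sigma> (\<sigma> i)), \<sigma> (\<sigma> (\<sigma> (\<sigma> i)))}"
      unfolding insert_iff eq h'\<sigma>
      by (rule cases5[OF h'5[of i]]; rule cases5[OF h'5[of j]]) simp_all
  qed
qed

locale pentagon =
  fixes \<sigma> :: "'t::finite \<Rightarrow> 't"
  assumes \<sigma>5: "\<And>i. \<sigma> (\<sigma> (\<sigma> (\<sigma> (\<sigma> i)))) = i"
    and \<sigma>_distinct: "\<And>i. distinct [i, \<sigma> i, \<sigma> (\<sigma> i), \<sigma> (\<sigma> (\<sigma> i)), \<sigma> (\<sigma> (\<sigma> (\<sigma> i)))]"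
    and \<sigma>_exhaust: "\<And>i j. j \<in> {i, \<sigma> i, \<sigma> (\<sigma> i), \<sigma> (\<sigma> (\<sigma> i)), \<sigma> (\<sigma> (\<sigma> (\<sigma> i)))}"
begin

definition adj :: "'t \<Rightarrow> 't \<Rightarrow> complex" where
  "adj i j = (if j = \<sigma> i \<or> i = \<sigma> j then 1 else 0)"

lemma \<sigma>_neq [simp]:
  "\<sigma> i \<noteq> i" "i \<noteq> \<sigma> i" "\<sigma> (\<sigma> i) \<noteq> i" "i \<noteq> \<sigma> (\<sigma> i)" "\<sigma> (\<sigma> (\<sigma> i)) \<noteq> i" "i \<noteq> \<sigma> (\<sigma> (\<sigma> i))"
  "\<sigma> (\<sigma> (\<sigma> (\<sigma> i))) \<noteq> i" "i \<noteq> \<sigma> (\<sigma> (\<sigma> (\<sigma> i)))"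
  using \<sigma>_distinct[of i] by auto

lemma \<sigma>_inj [simp]: "\<sigma> i = \<sigma> j \<longleftrightarrow> i = j"
  by (metis \<sigma>5)

lemma \<sigma>_cases:
  obtains "j = i" | "j = \<sigma> i" | "j = \<sigma> (\<sigma> i)" | "j = \<sigma> (\<sigma> (\<sigma> i))" | "j = \<sigma> (\<sigma> (\<sigma> (\<sigma> i)))"
  using \<sigma>_exhaust[of j i] by auto

lemma sum_pentagon:
  fixes f :: "'t \<Rightarrow> complex"
  shows "sum f UNIV = f i + f (\<sigma> i) + f (\<sigma> (\<sigma> i)) + f (\<sigma> (\<sigma> (\<sigma> i))) + f (\<sigma> (\<sigma> (\<sigma> (\<sigma> i))))"
proof -
  have "UNIV = {i, \<sigma> i, \<sigma> (\<sigma> i), \<sigma> (\<sigma> (\<sigma> i)), \<sigma> (\<sigma> (\<sigma> (\<sigma> i)))}"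
    using \<sigma>_exhaust by blast
  then have "sum f UNIV = sum f {i, \<sigma> i, \<sigma> (\<sigma> i), \<sigma> (\<sigma> (\<sigma> i)), \<sigma> (\<sigma> (\<sigma> (\<sigma> i)))}"
    by (rule arg_cong)
  then show ?thesis
    by (simp add: add.assoc)
qed

lemma adj_simps [simp]:
  "adj i i = 0" "adj i (\<sigma> i) = 1" "adj i (\<sigma> (\<sigma> i)) = 0" "adj i (\<sigma> (\<sigma> (\<sigma> i))) = 0"
  "adj i (\<sigma> (\<sigma> (\<sigma> (\<sigma> i)))) = 1"
  "adj (\<sigma> i) i = 1" "adj (\<sigma> (\<sigma> i)) i = 0" "adj (\<sigma> (\<sigma> (\<sigma> i))) i = 0"
  "adj (\<sigma> (\<sigma> (\<sigma> (\<sigma> i)))) i = 1"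
  by (simp_all add: adj_def \<sigma>5)

lemma adj_commute: "adj i j = adj j i"
  by (auto simp: adj_def)

lemma adj_sum: "(\<Sum>k\<in>UNIV. adj i k * f k) = f (\<sigma> i) + f (\<sigma> (\<sigma> (\<sigma> (\<sigma> i))))"
  by (subst sum_pentagon[of _ i]) simp

text \<open>A diagonal weight between two adjacency matrices only reaches the pairs at distance 0 and 2,
  a diagonal weight next to one adjacency matrix only the pairs at distance 1.\<close>

definition adj_form :: "('t \<Rightarrow> complex) \<Rightarrow> ('t \<Rightarrow> complex) \<Rightarrow> ('t \<Rightarrow> complex) \<Rightarrow> 't \<Rightarrow> 't \<Rightarrow> complex" where
  "adj_form p q r i j = (if i = j then p i else 0) + (q i + q j) * adj i j + (\<Sum>k\<in>UNIV. adj i k * (r k * adj k j))"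

lemma adj_form_simps:
  "adj_form p q r i i = p i + r (\<sigma> i) + r (\<sigma> (\<sigma> (\<sigma> (\<sigma> i))))"
  "adj_form p q r i (\<sigma> i) = q i + q (\<sigma> i)"
  "adj_form p q r i (\<sigma> (\<sigma> i)) = r (\<sigma> i)"
  unfolding adj_form_def adj_sum by (simp_all add: \<sigma>5)

lemma adj_form_commute: "adj_form p q r i j = adj_form p q r j i"
  by (simp add: adj_form_def adj_commute[of i] adj_commute[of _ j] mult_ac add_ac)

text \<open>Steps 3 and 4 along the cycle are steps 2 and 1 taken backwards, so symmetry leaves only
  the distances 0, 1 and 2.\<close>

lemma adj_form_cong:
  assumes "\<And>i j. H i j = H j i"
    and "\<And>i. H i i = adj_form p q r i i" "\<And>i. H i (\<sigma> i) = adj_form p q r i (\<sigma> i)"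
    "\<And>i. H i (\<sigma> (\<sigma> i)) = adj_form p q r i (\<sigma> (\<sigma> i))"
  shows "H i j = adj_form p q r i j"
proof (cases rule: \<sigma>_cases[of j i])
  case 4
  then have "i = \<sigma> (\<sigma> j)" by (simp add: \<sigma>5)
  then show ?thesis using assms(1,4) adj_form_commute by metis
next
  case 5
  then have "i = \<sigma> j" by (simp add: \<sigma>5)
  then show ?thesis using assms(1,3) adj_form_commute by metis
qed (auto simp: assms)

text \<open>A triangular system: vertices at distance 2 have a unique midpoint, which fixes
  \<open>r\<close>; the edges fix \<open>q\<close>, because the cycle is odd; the diagonal fixes
  \<open>p\<close>.\<close>

lemma adj_form_surj:
  assumes H: "\<And>i j. H i j = H j i"
  shows "\<exists>p q r. \<forall>i j. H i j = adj_form p q r i j"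
proof -
  define r where "r k = H (\<sigma> (\<sigma> (\<sigma> (\<sigma> k)))) (\<sigma> k)" for k
  define f where "f i = H i (\<sigma> i)" for i
  \<comment> \<open>In \<open>q i + q (\<sigma> i)\<close> the two alternating sums cancel except
    for \<open>f i\<close>, which occurs twice since the cycle is odd.\<close>
  define q where "q i = (f i - f (\<sigma> i) + f (\<sigma> (\<sigma> i)) - f (\<sigma> (\<sigma> (\<sigma> i))) + f (\<sigma> (\<sigma> (\<sigma> (\<sigma> i))))) / 2" for i
  define p where "p i = H i i - r (\<sigma> i) - r (\<sigma> (\<sigma> (\<sigma> (\<sigma> i))))" for i
  have q: "q i + q (\<sigma> i) = H i (\<sigma> i)" for i
    by (simp add: q_def \<sigma>5 field_simps) (simp add: f_def)
  have "H i j = adj_form p q r i j" for i j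
    by (rule adj_form_cong) (simp_all add: H adj_form_simps q, simp_all add: p_def r_def \<sigma>5)
  then show ?thesis by blast
qed

text \<open>After \<open>r\<close> and \<open>p\<close> are gone, \<open>q\<close> changes sign at
  every step of a cycle of odd length.\<close>

lemma adj_form_inj:
  assumes Z: "\<And>i j. adj_form p q r i j = 0"
  shows "p i = 0" "q i = 0" "r i = 0"
proof -
  have r: "r i = 0" for i
    using Z[of "\<sigma> (\<sigma> (\<sigma> (\<sigma> i)))" "\<sigma> i"] adj_form_simps(3)[of p q r "\<sigma> (\<sigma> (\<sigma> (\<sigma> i)))"] by (simp add: \<sigma>5)
  show "r i = 0" by (rule r)
  show "p i = 0"
    using Z[of i i] by (simp add: adj_form_simps r)
  have q: "q (\<sigma> i) = - q i" for i
    using Z[of i "\<sigma> i"] by (simp add: adj_form_simps add_eq_0_iff)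
  have "q i = - q i"
    using q[of "\<sigma> (\<sigma> (\<sigma> (\<sigma> i)))"] by (simp add: q \<sigma>5)
  then show "q i = 0" by simp
qed

text \<open>This is why the stabilizer at the base point is a line: distance 2 kills
  \<open>c\<close>, the diagonal then kills \<open>b\<close>, and the edges, read in both
  directions, link \<open>a\<close> and \<open>d\<close> until all their values equal one
  scalar.\<close>

lemma adj_stabilizer:
  assumes Z: "\<And>i j. (if i = j then b i else 0) + adj i j * d j - a i * adj i j
      - (\<Sum>k\<in>UNIV. adj i k * (c k * adj k j)) = 0"
  shows "a i = a j" "d i = a j" "b i = 0" "c i = 0"
proof -
  have c: "c i = 0" for i
    using Z[of "\<sigma> (\<sigma> (\<sigma> (\<sigma> i)))" "\<sigma> i"] unfolding adj_sum
    using adj_simps(3)[of "\<sigma> (\<sigma> (\<sigma> (\<sigma> i)))"] by (simp add: \<sigma>5)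
  show "c i = 0" by (rule c)
  show "b i = 0" using Z[of i i] by (simp add: c)
  have 1: "d (\<sigma> i) = a i" and 2: "d i = a (\<sigma> i)" for i
    using Z[of i "\<sigma> i"] Z[of "\<sigma> i" i] by (simp_all add: c)
  have "a (\<sigma> (\<sigma> i)) = a i" for i
    using 1 2 by metis
  \<comment> \<open>Three double steps amount to one step of the five-cycle.\<close>
  then have 3: "a (\<sigma> i) = a i" for i
    by (metis \<sigma>5)
  show *: "a i = a j" for i j
    by (rule \<sigma>_cases[of j i]) (simp_all add: 3)
  show "d i = a j" using 2 * by metis
qed

text \<open>A double step negates \<open>f\<close>, hence so does a single step, being three double
  steps; two single steps then give \<open>f = - f\<close>. This makes the adjacency matrix
  invertible.\<close>

lemma adj_inj:
  assumes "\<And>i. (\<Sum>k\<in>UNIV. adj i k * f k) = 0"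
  shows "f i = 0"
proof -
  have s: "f (\<sigma> (\<sigma> i)) = - f i" for i
    using assms[of "\<sigma> i"] unfolding adj_sum by (simp add: \<sigma>5 add_eq_0_iff2)
  have "f (\<sigma> i) = - f i" for i
    using s[of "\<sigma> (\<sigma> i)"] s[of "\<sigma> (\<sigma> (\<sigma> (\<sigma> i)))"] s[of i] by (simp add: \<sigma>5)
  then have "f (\<sigma> (\<sigma> i)) = f i" by simp
  with s[of i] show ?thesis by simp
qed

end

section \<open>Block diagonal matrices\<close>

lemma UNIV_coord: "(UNIV :: coord set) = {X, Y}"
  using coord.exhaust by blast

lemma sum_coord: "(\<Sum>c\<in>UNIV. f c) = f X + f Y"
  by (simp add: UNIV_coord)

lemma sum_times: "(\<Sum>p\<in>UNIV. f p) = (\<Sum>t\<in>UNIV. \<Sum>c\<in>UNIV. f (t, c))"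
  by (simp add: sum.cartesian_product flip: UNIV_Times_UNIV)

definition block_diag :: "complex ^ ('t \<times> coord) ^ ('t::finite \<times> coord) \<Rightarrow> bool" where
  "block_diag A \<longleftrightarrow> (\<forall>p q. fst p \<noteq> fst q \<longrightarrow> A $ p $ q = 0)"

lemma block_diag_add: "block_diag A \<Longrightarrow> block_diag B \<Longrightarrow> block_diag (A + B)"
  and block_diag_diff: "block_diag A \<Longrightarrow> block_diag B \<Longrightarrow> block_diag (A - B)"
  and block_diag_minus: "block_diag A \<Longrightarrow> block_diag (- A)"
  and block_diag_mat: "block_diag (mat c)"
  by (auto simp: block_diag_def transpose_def mat_def)

lemma block_diag_mul:
  assumes "block_diag A" "block_diag B"
  shows "block_diag (A ** B)"
  unfolding block_diag_def
proof (intro allI impI)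
  fix p q :: "'a \<times> coord"
  assume "fst p \<noteq> fst q"
  then have "A $ p $ k * B $ k $ q = 0" for k
    using assms unfolding block_diag_def by (metis mult_zero_left mult_zero_right)
  then have "(\<Sum>k\<in>UNIV. A $ p $ k * B $ k $ q) = 0"
    by (intro sum.neutral ballI)
  then show "(A ** B) $ p $ q = 0"
    by (simp add: matrix_matrix_mult_def)
qed

text \<open>A block diagonal matrix commutes with the projection \<open>E\<close> onto a block,
  hence so does its inverse, and this forces the entries between that block and the others to
  vanish.\<close>

lemma block_diag_inverse:
  assumes A: "block_diag A" and AB: "A ** B = mat 1" and BA: "B ** A = mat 1"
  shows "block_diag B"
  unfolding block_diag_def
proof (intro allI impI)
  fix p q :: "'a \<times> coord"
  assume ne: "fst p \<noteq> fst q"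
  define E :: "complex ^ ('a \<times> coord) ^ ('a \<times> coord)"
    where "E = (\<chi> i j. if i = j then if fst i = fst p then 1 else 0 else 0)"
  have E_mul: "(E ** M) $ i $ j = (if fst i = fst p then M $ i $ j else 0)"
    and mul_E: "(M ** E) $ i $ j = (if fst j = fst p then M $ i $ j else 0)" for M i j
    by (simp_all add: E_def matrix_matrix_mult_def if_distrib[of "\<lambda>x. x * _"]
        if_distrib[of "\<lambda>x. _ * x"] cong: if_cong)
  have "E ** A = A ** E"
    using A by (auto simp: vec_eq_iff E_mul mul_E block_diag_def)
  then have "B ** (E ** A) ** B = B ** (A ** E) ** B" by simp
  then have "B ** E = E ** B"
    by (simp add: matrix_mul_assoc BA) (simp add: AB flip: matrix_mul_assoc)
  then show "B $ p $ q = 0"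
    using E_mul[of B p q] mul_E[of B p q] ne by auto
qed

lemma block_diag_eqI:
  assumes "block_diag A" "block_diag B" "\<And>t c d. A $ (t, c) $ (t, d) = B $ (t, c) $ (t, d)"
  shows "A = B"
  unfolding vec_eq_iff
proof (intro allI)
  fix p q show "A $ p $ q = B $ p $ q"
    using assms by (cases p; cases q; cases "fst p = fst q") (auto simp: block_diag_def)
qed

lemma block_diag_sandwich:
  assumes "block_diag A"
  shows "(transpose U ** A ** V) $ i $ j =
    (\<Sum>t\<in>UNIV. \<Sum>c\<in>UNIV. \<Sum>d\<in>UNIV. U $ (t, c) $ i * A $ (t, c) $ (t, d) * V $ (t, d) $ j)"
proof -
  have "(transpose U ** A ** V) $ i $ j = (\<Sum>q\<in>UNIV. \<Sum>p\<in>UNIV. U $ p $ i * A $ p $ q * V $ q $ j)"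
    by (simp add: matrix_matrix_mult_def transpose_def sum_distrib_right)
  also have "\<dots> = (\<Sum>p\<in>UNIV. \<Sum>q\<in>UNIV. U $ p $ i * A $ p $ q * V $ q $ j)"
    by (rule sum.swap)
  also have "\<dots> = (\<Sum>t\<in>UNIV. \<Sum>c\<in>UNIV. \<Sum>t'\<in>UNIV. if t = t' then
      (\<Sum>d\<in>UNIV. U $ (t, c) $ i * A $ (t, c) $ (t', d) * V $ (t', d) $ j) else 0)"
    unfolding sum_times using assms by (intro sum.cong refl) (auto simp: block_diag_def)
  finally show ?thesis by simp
qed

section \<open>The infinitesimal stabilizer of a Gaussian weight\<close>

text \<open>A coordinate vector for the element \<open>(\<alpha>, \<beta>; \<gamma>, -\<alpha>\<^sup>T)\<close> of the sum of the five Lie algebras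
  \<open>sp(4)\<close>. The entries of the symmetric \<open>\<beta>\<close> and \<open>\<gamma>\<close> are indexed by an option, with
  \<open>None\<close> for the off-diagonal one.\<close>

type_synonym 't gauge_index = "'t \<times> (coord \<times> coord + coord option + coord option)"

definition alpha_block :: "complex ^ 't::finite gauge_index \<Rightarrow> complex ^ ('t \<times> coord) ^ ('t \<times> coord)" where
  "alpha_block x = (\<chi> p q. if fst p = fst q then x $ (fst p, Inl (snd p, snd q)) else 0)"

definition beta_block :: "complex ^ 't::finite gauge_index \<Rightarrow> complex ^ ('t \<times> coord) ^ ('t \<times> coord)" where
  "beta_block x = (\<chi> p q. if fst p = fst q
    then x $ (fst p, Inr (Inl (if snd p = snd q then Some (snd p) else None))) else 0)"

definition gamma_block :: "complex ^ 't::finite gauge_index \<Rightarrow> complex ^ ('t \<times> coord) ^ ('t \<times> coord)" where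
  "gamma_block x = (\<chi> p q. if fst p = fst q
    then x $ (fst p, Inr (Inr (if snd p = snd q then Some (snd p) else None))) else 0)"

lemma block_diag_gauge: "block_diag (alpha_block x)" "block_diag (beta_block x)" "block_diag (gamma_block x)"
  by (auto simp: block_diag_def alpha_block_def beta_block_def gamma_block_def)

lemma sym_gauge: "transpose (beta_block x) = beta_block x" "transpose (gamma_block x) = gamma_block x"
  by (auto simp: transpose_def vec_eq_iff beta_block_def gamma_block_def)

lemma gauge_exists:
  assumes "block_diag A" "block_diag B" "block_diag C" and "transpose B = B" "transpose C = C"
  obtains x where "alpha_block x = A" "beta_block x = B" "gamma_block x = C"
proof -
  define e where "e M t k = (case k of Some c \<Rightarrow> M $ (t, c) $ (t, c) | None \<Rightarrow> M $ (t, X) $ (t, Y))"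
    for M :: "complex ^ ('a \<times> coord) ^ ('a \<times> coord)" and t k
  have e: "e M t (if c = d then Some d else None) = M $ (t, c) $ (t, d)" if "transpose M = M" for M t c d
  proof -
    have "M $ (t, X) $ (t, Y) = M $ (t, Y) $ (t, X)"
      using that by (metis (no_types) transpose_def vec_lambda_beta)
    then show ?thesis by (cases c; cases d) (auto simp: e_def)
  qed
  define x :: "complex ^ 'a gauge_index" where "x = (\<chi> i. case snd i of
     Inl (c, d) \<Rightarrow> A $ (fst i, c) $ (fst i, d) | Inr (Inl k) \<Rightarrow> e B (fst i) k | Inr (Inr k) \<Rightarrow> e C (fst i) k)"
  note e_B = e[OF assms(4)] and e_C = e[OF assms(5)]
  have "alpha_block x = A" "beta_block x = B" "gamma_block x = C"
    by (rule block_diag_eqI[OF block_diag_gauge(1) assms(1)] block_diag_eqI[OF block_diag_gauge(2) assms(2)]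
        block_diag_eqI[OF block_diag_gauge(3) assms(3)]; simp add: alpha_block_def beta_block_def gamma_block_def x_def e_B e_C split del: if_split cong: if_cong)+
  then show ?thesis using that by blast
qed

lemma gauge_eq_0:
  assumes "alpha_block x = 0" "beta_block x = 0" "gamma_block x = 0"
  shows "x = 0"
proof -
  have a: "x $ (t, Inl (c, d)) = 0" for t c d
    using arg_cong[OF assms(1), of "\<lambda>M. M $ (t, c) $ (t, d)"] by (simp add: alpha_block_def)
  have b: "x $ (t, Inr (Inl k)) = 0" for t k
    using arg_cong[OF assms(2), of "\<lambda>M. M $ (t, X) $ (t, Y)"]
      arg_cong[OF assms(2), of "\<lambda>M. M $ (t, the k) $ (t, the k)"]
    by (cases k) (simp_all add: beta_block_def)
  have c: "x $ (t, Inr (Inr k)) = 0" for t k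
    using arg_cong[OF assms(3), of "\<lambda>M. M $ (t, X) $ (t, Y)"]
      arg_cong[OF assms(3), of "\<lambda>M. M $ (t, the k) $ (t, the k)"]
    by (cases k) (simp_all add: gamma_block_def)
  have "x $ (t, k) = 0" for t k
    using a b c by (cases k; cases "projl k"; cases "projr k") auto
  then show ?thesis by (simp add: vec_eq_iff)
qed

text \<open>For symmetric \<open>F\<close> the Lagrangian subspace is the graph
  \<open>m = F d\<close>. It is mapped into itself by
  \<open>(\<alpha>, \<beta>; \<gamma>, -\<alpha>\<^sup>T)\<close> exactly when
  \<open>\<gamma> - \<alpha>\<^sup>T F = F (\<alpha> + \<beta> F)\<close>; \<open>stab\<close> is
  the defect.\<close>

definition stab :: "complex ^ ('t::finite \<times> coord) ^ ('t \<times> coord) \<Rightarrow> complex ^ 't gauge_index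
    \<Rightarrow> complex ^ ('t \<times> coord) ^ ('t \<times> coord)" where
  "stab F x = F ** beta_block x ** F + F ** alpha_block x + transpose (alpha_block x) ** F - gamma_block x"

lemma gauge_add: "alpha_block (x + y) = alpha_block x + alpha_block y" "beta_block (x + y) = beta_block x + beta_block y" "gamma_block (x + y) = gamma_block x + gamma_block y"
  by (auto simp: vec_eq_iff alpha_block_def beta_block_def gamma_block_def)

lemma mat_mul_nth: "(mat c ** A) $ i $ j = c * A $ i $ j"
  by (simp add: matrix_matrix_mult_def mat_def if_distrib[of "\<lambda>x. x * _"] cong: if_cong)

lemma mat_commute: "A ** mat c = mat c ** (A :: 'a::comm_semiring_1 ^ 'n ^ 'n)"
  by (simp add: vec_eq_iff mat_mul_nth)
    (simp add: matrix_matrix_mult_def mat_def if_distrib[of "\<lambda>x. _ * x"] mult.commute cong: if_cong)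

lemma gauge_scale: "alpha_block (c *s x) = mat c ** alpha_block x" "beta_block (c *s x) = mat c ** beta_block x"
  "gamma_block (c *s x) = mat c ** gamma_block x"
  by (auto simp: vec_eq_iff mat_mul_nth alpha_block_def beta_block_def gamma_block_def)

lemma stab_scale: "stab F (c *s x) = mat c ** stab F x"
  by (simp add: stab_def gauge_scale mat_ring transpose_simps mat_commute[of _ c])

lemma stab_linear: "Vector_Spaces.linear (*s) (*) (\<lambda>x. stab F x $ p $ q)"
proof unfold_locales
  show "stab F (x + y) $ p $ q = stab F x $ p $ q + stab F y $ p $ q" for x y
    by (simp add: stab_def gauge_add mat_ring transpose_simps)
  show "stab F (c *s x) $ p $ q = c * stab F x $ p $ q" for c x
    by (simp add: stab_scale mat_mul_nth)
qed

text \<open>The equation \<open>None\<close> normalises the coordinate \<open>i0\<close>.\<close>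

definition stab_system :: "'t::finite gauge_index \<Rightarrow> complex ^ ('t \<times> coord) ^ ('t \<times> coord)
    \<Rightarrow> complex ^ 't gauge_index ^ (('t \<times> coord) \<times> ('t \<times> coord)) option" where
  "stab_system i0 F = (\<chi> e i. case e of None \<Rightarrow> (if i = i0 then 1 else 0)
     | Some (p, q) \<Rightarrow> stab F (axis i 1) $ p $ q)"

lemma stab_system_mul:
  "(stab_system i0 F *v x) $ e = (case e of None \<Rightarrow> x $ i0 | Some (p, q) \<Rightarrow> stab F x $ p $ q)"
proof (cases e)
  case None
  then show ?thesis
    by (simp add: matrix_vector_mult_def stab_system_def if_distrib[of "\<lambda>x. x * _"] cong: if_cong)
next
  case (Some pq)
  obtain p q where pq: "pq = (p, q)" by (cases pq)
  interpret l: Vector_Spaces.linear "(*s)" "(*)" "\<lambda>x. stab F x $ p $ q" by (rule stab_linear)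
  have "stab F x $ p $ q = stab F (\<Sum>i\<in>UNIV. x $ i *s axis i 1) $ p $ q"
    by (simp add: basis_expansion)
  also have "\<dots> = (\<Sum>i\<in>UNIV. x $ i * stab F (axis i 1) $ p $ q)"
    by (simp add: l.sum l.scale)
  finally show ?thesis
    by (simp add: Some pq matrix_vector_mult_def stab_system_def mult.commute)
qed

lemma poly_funs_gauge:
  assumes "\<And>i. (\<lambda>F. x F $ i) \<in> poly_funs C"
  shows "(\<lambda>F. alpha_block (x F) $ p $ q) \<in> poly_funs C" "(\<lambda>F. beta_block (x F) $ p $ q) \<in> poly_funs C"
    "(\<lambda>F. gamma_block (x F) $ p $ q) \<in> poly_funs C"
  by (simp_all add: alpha_block_def beta_block_def gamma_block_def poly_funs_if assms poly_funs.const)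

lemma poly_funs_stab:
  assumes "\<And>i. (\<lambda>F. x F $ i) \<in> mpolys"
  shows "(\<lambda>F. stab F (x F) $ p $ q) \<in> mpolys"
proof -
  have "(\<lambda>F. transpose (alpha_block (x F)) $ p $ q) \<in> mpolys" for p q
    using poly_funs_gauge(1)[OF assms] by (simp add: transpose_def)
  then show ?thesis
    unfolding stab_def vector_add_component vector_minus_component
    by (intro poly_funs.add poly_funs_diff poly_funs_matrix_mul poly_funs_gauge assms mpolys_coord)
qed

lemma poly_funs_stab_system: "(\<lambda>F. stab_system i0 F $ e $ i) \<in> mpolys"
  by (cases e) (auto simp: stab_system_def poly_funs.const intro!: poly_funs_stab)

section \<open>The base point\<close>

context pentagon
begin

text \<open>In the coordinates \<open>(x, y)\<close>, with \<open>S\<close> the adjacency matrix of the pentagon, \<open>w0 = (1; S)\<close> and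
  \<open>k0 = (-S; 1)\<close>, so that the columns of \<open>k0\<close> span the kernel of the transpose of \<open>w0\<close>.\<close>

definition w0 :: "complex ^ 't ^ ('t \<times> coord)" where
  "w0 = (\<chi> p j. if snd p = X then (if fst p = j then 1 else 0) else adj (fst p) j)"

definition k0 :: "complex ^ 't ^ ('t \<times> coord)" where
  "k0 = (\<chi> p j. if snd p = Y then (if fst p = j then 1 else 0) else - adj (fst p) j)"

definition sel :: "coord \<Rightarrow> complex ^ 't ^ ('t \<times> coord)" where
  "sel c = (\<chi> p j. if snd p = c \<and> fst p = j then 1 else 0)"

definition S0 :: "complex ^ 't ^ 't" where
  "S0 = (\<chi> i j. adj i j)"

lemma delta_sums:
  fixes f g :: "'t \<Rightarrow> complex"
  shows "(\<Sum>t\<in>UNIV. (if t = i then 1 else 0) * f t * (if t = j then 1 else 0)) = (if i = j then f i else 0)"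
    "(\<Sum>t\<in>UNIV. (if t = i then 1 else 0) * f t * g t) = f i * g i"
    "(\<Sum>t\<in>UNIV. g t * f t * (if t = i then 1 else 0)) = g i * f i"
    "(\<Sum>t\<in>UNIV. (if t = i then 1 else 0) * f t) = f i"
    "(\<Sum>t\<in>UNIV. (if i = t then 1 else 0) * f t) = f i"
    "(\<Sum>t\<in>UNIV. f t * (if i = t then 1 else 0)) = f i"
    "(\<Sum>t\<in>UNIV. f t * (if t = i then 1 else 0)) = f i"
  by (simp_all add: if_distrib[of "\<lambda>x. _ * x"] if_distrib[of "\<lambda>x. x * _"] cong: if_cong)

lemma base_nth [simp]:
  "w0 $ (t, X) $ j = (if t = j then 1 else 0)" "w0 $ (t, Y) $ j = adj t j"
  "k0 $ (t, X) $ j = - adj t j" "k0 $ (t, Y) $ j = (if t = j then 1 else 0)"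
  "sel X $ (t, X) $ j = (if t = j then 1 else 0)" "sel X $ (t, Y) $ j = 0"
  "sel Y $ (t, X) $ j = 0" "sel Y $ (t, Y) $ j = (if t = j then 1 else 0)"
  by (simp_all add: w0_def k0_def sel_def)

lemma w0_k0: "transpose w0 ** k0 = 0"
  by (auto simp: vec_eq_iff matrix_matrix_mult_def transpose_def sum_times sum_coord
      sum_subtractf sum.distrib sum_negf delta_sums adj_commute)

lemma sel_w0: "transpose (sel X) ** w0 = mat 1"
  by (auto simp: vec_eq_iff matrix_matrix_mult_def transpose_def sum_times sum_coord
      mat_def delta_sums)

text \<open>Splits every vector into a part in the column space of \<open>sel X\<close> and a part
  in that of \<open>k0\<close>, the kernel of \<open>transpose w0\<close>.\<close>

lemma complement: "sel X ** transpose w0 + k0 ** transpose (sel Y) = mat 1"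
proof -
  have "(sel X ** transpose w0 + k0 ** transpose (sel Y)) $ (t, c) $ (t', c') = mat 1 $ (t, c) $ (t', c')"
    for t t' c c'
    by (cases c; cases c') (simp_all add: matrix_matrix_mult_def transpose_def
      mat_def delta_sums sum_negf adj_commute)
  then show ?thesis by (simp add: vec_eq_iff)
qed

text \<open>As \<open>w0 = (1; S)\<close>, blocks with entries \<open>p\<close>, \<open>q\<close>,
  \<open>r\<close> give \<open>p + q S + S q + S r S\<close>, which is what \<open>adj_form\<close>
  encodes.\<close>

lemma w0_form:
  assumes "block_diag B" "transpose B = B"
  shows "(transpose w0 ** B ** w0) $ i $ j = adj_form (\<lambda>t. B $ (t, X) $ (t, X))
    (\<lambda>t. B $ (t, X) $ (t, Y)) (\<lambda>t. B $ (t, Y) $ (t, Y)) i j"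
proof -
  have s: "B $ (t, Y) $ (t, X) = B $ (t, X) $ (t, Y)" for t
    using assms(2) by (metis (no_types) transpose_def vec_lambda_beta)
  show ?thesis
    unfolding block_diag_sandwich[OF assms(1)] sum_coord
    by (simp add: sum.distrib sum_subtractf sum_negf delta_sums s)
      (simp add: adj_form_def adj_commute distrib_left right_diff_distrib mult_ac)
qed

text \<open>For \<open>k0 = (-S; 1)\<close> the coordinates \<open>X\<close> and \<open>Y\<close>
  trade places and the mixed term changes sign.\<close>

lemma k0_form:
  assumes "block_diag B" "transpose B = B"
  shows "(transpose k0 ** B ** k0) $ i $ j = adj_form (\<lambda>t. B $ (t, Y) $ (t, Y))
    (\<lambda>t. - B $ (t, X) $ (t, Y)) (\<lambda>t. B $ (t, X) $ (t, X)) i j"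
proof -
  have s: "B $ (t, Y) $ (t, X) = B $ (t, X) $ (t, Y)" for t
    using assms(2) by (metis (no_types) transpose_def vec_lambda_beta)
  show ?thesis
    unfolding block_diag_sandwich[OF assms(1)] sum_coord
    by (simp add: sum.distrib sum_subtractf sum_negf delta_sums s)
      (simp add: adj_form_def adj_commute distrib_left right_diff_distrib mult_ac)
qed

text \<open>The right-hand side has the shape of the hypothesis of
  \<open>adj_stabilizer\<close>.\<close>

lemma w0_k0_form:
  assumes "block_diag A"
  shows "(transpose w0 ** A ** k0) $ i $ j =
    (if i = j then A $ (i, X) $ (i, Y) else 0) + adj i j * A $ (j, Y) $ (j, Y)
      - A $ (i, X) $ (i, X) * adj i j - (\<Sum>t\<in>UNIV. adj i t * (A $ (t, Y) $ (t, X) * adj t j))"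
  unfolding block_diag_sandwich[OF assms(1)] sum_coord
  by (simp add: sum.distrib sum_subtractf sum_negf delta_sums)
    (simp add: adj_commute[of _ i] mult_ac)

end

section \<open>Linear maps on matrices, for differentiation\<close>

lemma matrix_bounded_bilinear:
  "bounded_bilinear ((**) :: complex ^ 'n ^ 'm \<Rightarrow> complex ^ 'k ^ 'n \<Rightarrow> complex ^ 'k ^ 'm)"
proof -
  have "bilinear ((**) :: complex ^ 'n ^ 'm \<Rightarrow> complex ^ 'k ^ 'n \<Rightarrow> complex ^ 'k ^ 'm)"
    unfolding bilinear_def
    by (intro conjI allI linearI)
      (simp_all add: distrib_left distrib_right sum.distrib matrix_matrix_mult_def vec_eq_iff scaleR_sum_right)
  then show ?thesis
    by (simp add: bilinear_conv_bounded_bilinear)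
qed

lemma transpose_bounded_linear:
  "bounded_linear (transpose :: complex ^ 'n ^ 'm \<Rightarrow> complex ^ 'm ^ 'n)"
  unfolding linear_conv_bounded_linear[symmetric]
  by (rule linearI) (simp_all add: transpose_add transpose_scalar)

definition half :: "complex ^ 'n ^ 'm \<Rightarrow> complex ^ 'n ^ 'm::finite" where
  "half A = mat (1 / 2) ** A"

lemma half_add: "half A + half A = A"
  by (simp add: half_def mat_mul_nth vec_eq_iff)

lemma transpose_half: "transpose (half A) = half (transpose A)"
  by (simp add: half_def mat_mul_nth vec_eq_iff transpose_def)

lemma sym_antisym_parts: "A = half (A + transpose A) + (half A - transpose (half A))"
  by (simp add: vec_eq_iff half_def mat_mul_nth transpose_def field_simps)

text \<open>A linear map onto the symmetric block diagonal matrices; it lets the parameters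
  \<open>s\<close> and \<open>k\<close> of the deformation range over all matrices.\<close>

definition block_sym :: "complex ^ ('t \<times> coord) ^ ('t::finite \<times> coord) \<Rightarrow> complex ^ ('t \<times> coord) ^ ('t \<times> coord)" where
  "block_sym A = (\<chi> p q. if fst p = fst q then A $ p $ q + A $ q $ p else 0)"

lemma block_diag_block_sym: "block_diag (block_sym A)"
  by (auto simp: block_diag_def block_sym_def)

lemma transpose_block_sym: "transpose (block_sym A) = block_sym A"
  by (auto simp: transpose_def block_sym_def vec_eq_iff)

lemma block_sym_bounded_linear: "bounded_linear block_sym"
  unfolding linear_conv_bounded_linear[symmetric]
  by (rule linearI) (auto simp: block_sym_def vec_eq_iff scaleR_add_right)

lemma block_sym_half:
  assumes "block_diag A" "transpose A = A"
  shows "block_sym (half A) = A"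
proof (rule block_diag_eqI[OF block_diag_block_sym assms(1)])
  fix t c d
  have "A $ (t, d) $ (t, c) = A $ (t, c) $ (t, d)"
    using assms(2) by (metis (no_types) transpose_def vec_lambda_beta)
  then show "block_sym (half A) $ (t, c) $ (t, d) = A $ (t, c) $ (t, d)"
    by (simp add: block_sym_def half_def mat_mul_nth)
qed

lemma sym_blocks:
  fixes f g h :: "'t::finite \<Rightarrow> complex"
  obtains B where "block_diag B" "transpose B = B"
    "\<And>t. B $ (t, X) $ (t, X) = f t" "\<And>t. B $ (t, X) $ (t, Y) = g t" "\<And>t. B $ (t, Y) $ (t, Y) = h t"
  by (rule that[of "\<chi> p q. if fst p = fst q
      then (if snd p = snd q then if snd p = X then f (fst p) else h (fst p) else g (fst p)) else 0"])
    (auto simp: block_diag_def transpose_def vec_eq_iff)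

lemma transpose_nth: "transpose A $ i $ j = A $ j $ i"
  by (simp add: transpose_def)

section \<open>Quadratic forms and the stabilizer at the base point\<close>

context pentagon
begin

lemma card_UNIV: "CARD('t) = 5"
  using sum_pentagon[of "\<lambda>_. 1"] by (simp add: of_nat_eq_iff[where 'a=complex, symmetric])

lemma transpose_S0: "transpose S0 = S0"
  by (simp add: S0_def transpose_def adj_commute)

definition N0 :: "complex ^ 't ^ 't" where
  "N0 = (SOME N. N ** S0 = mat 1)"

lemma N0_S0: "N0 ** S0 = mat 1"
proof -
  have "x = 0" if "S0 *v x = 0" for x
    using adj_inj[of "\<lambda>i. x $ i"] arg_cong[OF that, of "\<lambda>v. v $ _"]
    by (simp add: vec_eq_iff matrix_vector_mult_def S0_def)
  then have "\<exists>N. N ** S0 = mat 1"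
    by (simp add: matrix_left_invertible_ker)
  then show ?thesis
    unfolding N0_def by (rule someI_ex)
qed

lemma S0_N0: "S0 ** N0 = mat 1"
  using N0_S0 matrix_left_right_inverse by blast

lemma cancel: "A ** N0 ** S0 = A" "A ** S0 ** N0 = A"
  by (simp_all add: N0_S0 S0_N0 flip: matrix_mul_assoc)

lemma transpose_N0: "transpose N0 = N0"
proof -
  have "transpose N0 ** S0 = mat 1"
    using arg_cong[OF S0_N0, of transpose] by (simp add: transpose_simps transpose_S0)
  then have "transpose N0 ** S0 ** N0 = N0" by simp
  then show ?thesis
    by (simp add: S0_N0 flip: matrix_mul_assoc)
qed

text \<open>Makes the derivative of the deformation surjective in its second component, and provides
  the initial \<open>k\<close>.\<close>

lemma kappa_exists:
  assumes "transpose H = H"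
  obtains B where "block_diag B" "transpose B = B" "transpose w0 ** B ** w0 = H"
proof -
  have "H $ i $ j = H $ j $ i" for i j
    using assms by (metis transpose_nth)
  then obtain p q r where pqr: "\<And>i j. H $ i $ j = adj_form p q r i j"
    using adj_form_surj[of "\<lambda>i j. H $ i $ j"] by blast
  obtain B where B: "block_diag B" "transpose B = B"
    "\<And>t. B $ (t, X) $ (t, X) = p t" "\<And>t. B $ (t, X) $ (t, Y) = q t" "\<And>t. B $ (t, Y) $ (t, Y) = r t"
    using sym_blocks[of p q r] by blast
  have "transpose w0 ** B ** w0 = H"
    unfolding vec_eq_iff w0_form[OF B(1,2)] pqr B by blast
  with B that show ?thesis by blast
qed

text \<open>Block diagonal shifts realise every symmetric form on the kernel of
  \<open>transpose w0\<close>, the part of a variation of \<open>F\<close> that a change of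
  \<open>w\<close> cannot reach.\<close>

lemma shift_exists:
  assumes "transpose H = H"
  obtains B where "block_diag B" "transpose B = B" "transpose k0 ** B ** k0 = H"
proof -
  have "H $ i $ j = H $ j $ i" for i j
    using assms by (metis transpose_nth)
  then obtain p q r where pqr: "\<And>i j. H $ i $ j = adj_form p q r i j"
    using adj_form_surj[of "\<lambda>i j. H $ i $ j"] by blast
  obtain B where B: "block_diag B" "transpose B = B"
    "\<And>t. B $ (t, X) $ (t, X) = r t" "\<And>t. B $ (t, X) $ (t, Y) = - q t" "\<And>t. B $ (t, Y) $ (t, Y) = p t"
    using sym_blocks[of r "\<lambda>t. - q t" p] by blast
  have "transpose k0 ** B ** k0 = H"
    unfolding vec_eq_iff k0_form[OF B(1,2)] pqr B minus_minus by blast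
  with B that show ?thesis by blast
qed

lemma w0_form_inj:
  assumes "block_diag B" "transpose B = B" "transpose w0 ** B ** w0 = 0"
  shows "B = 0"
proof (rule block_diag_eqI[OF assms(1)])
  fix t c d
  note z = adj_form_inj[OF trans[OF w0_form[OF assms(1,2), symmetric]], unfolded assms(3)]
  have "B $ (t, Y) $ (t, X) = B $ (t, X) $ (t, Y)"
    using assms(2) by (metis transpose_nth)
  with z(1,2,3)[of t] show "B $ (t, c) $ (t, d) = 0 $ (t, c) $ (t, d)"
    by (cases c; cases d) simp_all
qed (simp add: block_diag_def)

lemma k0_form_inj:
  assumes "block_diag B" "transpose B = B" "transpose k0 ** B ** k0 = 0"
  shows "B = 0"
proof (rule block_diag_eqI[OF assms(1)])
  fix t c d
  note z = adj_form_inj[OF trans[OF k0_form[OF assms(1,2), symmetric]], unfolded assms(3)]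
  have "B $ (t, Y) $ (t, X) = B $ (t, X) $ (t, Y)"
    using assms(2) by (metis transpose_nth)
  with z(1,2,3)[of t] show "B $ (t, c) $ (t, d) = 0 $ (t, c) $ (t, d)"
    by (cases c; cases d) simp_all
qed (simp add: block_diag_def)

definition F0 :: "complex ^ ('t \<times> coord) ^ ('t \<times> coord)" where
  "F0 = w0 ** N0 ** transpose w0"

lemma transpose_F0: "transpose F0 = F0"
  by (simp add: F0_def transpose_simps transpose_N0 matrix_mul_assoc)

text \<open>The stabilizer equation is sandwiched between the kernel \<open>k0\<close> and a left inverse of \<open>w0\<close>.\<close>

lemma stab_F0_kernel:
  assumes st: "stab F0 x = 0" and norm: "x $ (t0, Inl (X, X)) = 0"
  shows "x = 0"
proof -
  have Fk: "F0 ** k0 = 0"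
    by (simp add: F0_def w0_k0 flip: matrix_mul_assoc)
  have kF: "transpose k0 ** F0 = 0"
    using arg_cong[OF Fk, of transpose] by (simp add: transpose_simps transpose_F0)
  \<comment> \<open>Apart from \<open>\<gamma>\<close>, every term has \<open>F0\<close> at one end
    and dies between the two copies of \<open>k0\<close>.\<close>
  have "transpose k0 ** stab F0 x ** k0 = - (transpose k0 ** gamma_block x ** k0)"
    by (simp add: stab_def mat_ring kF) (simp add: Fk flip: matrix_mul_assoc)
  then have gamma_block: "gamma_block x = 0"
    by (intro k0_form_inj block_diag_gauge sym_gauge) (simp add: st)
  \<comment> \<open>This left factor turns \<open>F0\<close> into \<open>transpose w0\<close>; with
    \<open>k0\<close> on the right only the term \<open>F0 \<alpha>\<close> will survive.\<close>
  have left: "S0 ** transpose (sel X) ** F0 = transpose w0"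
    by (simp add: F0_def matrix_mul_assoc)
      (simp add: sel_w0 S0_N0 flip: matrix_mul_assoc)
  have "S0 ** transpose (sel X) ** stab F0 x ** k0 = transpose w0 ** alpha_block x ** k0"
    by (simp add: stab_def mat_ring gamma_block left) (simp add: Fk flip: matrix_mul_assoc)
  then have "transpose w0 ** alpha_block x ** k0 = 0"
    by (simp add: st)
  \<comment> \<open>Hence \<open>\<alpha>\<close> is one common scalar matrix, which the
    normalisation makes zero.\<close>
  note z = adj_stabilizer[OF w0_k0_form[OF block_diag_gauge(1), of x, unfolded this, symmetric,
      unfolded zero_index]]
  have "alpha_block x $ (t0, X) $ (t0, X) = 0"
    using norm by (simp add: alpha_block_def)
  with z have z': "alpha_block x $ (t, X) $ (t, X) = 0" "alpha_block x $ (t, Y) $ (t, Y) = 0"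
    "alpha_block x $ (t, X) $ (t, Y) = 0" "alpha_block x $ (t, Y) $ (t, X) = 0" for t
    using z(1)[of t t0] z(2)[of t t0] z(3,4)[of t] by simp_all
  have alpha_block: "alpha_block x = 0"
  proof (rule block_diag_eqI[OF block_diag_gauge(1)])
    show "alpha_block x $ (t, c) $ (t, d) = 0 $ (t, c) $ (t, d)" for t c d
      using z' by (cases c; cases d) simp_all
  qed (simp add: block_diag_def)
  have right: "F0 ** sel X ** S0 = w0"
    using arg_cong[OF left, of transpose]
    by (simp add: transpose_simps transpose_F0 transpose_S0 matrix_mul_assoc)
  \<comment> \<open>With \<open>\<alpha>\<close> and \<open>\<gamma>\<close> gone only
    \<open>F0 \<beta> F0\<close> is left, and it compresses to a form in \<open>w0\<close>.\<close>
  have "S0 ** transpose (sel X) ** stab F0 x ** sel X ** S0 = transpose w0 ** beta_block x ** w0"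
    by (simp add: stab_def mat_ring gamma_block alpha_block left transpose_0) (simp add: right[folded matrix_mul_assoc] flip: matrix_mul_assoc)
  then have "beta_block x = 0"
    by (intro w0_form_inj block_diag_gauge sym_gauge) (simp add: st)
  then show ?thesis
    using alpha_block gamma_block gauge_eq_0 by blast
qed

section \<open>Deforming the base point\<close>

text \<open>Expanding \<open>H\<close> on both sides along the resolution of the identity in
  \<open>complement\<close>, the hypothesis removes the one term without a factor
  \<open>w0\<close>.\<close>

lemma transpose_w0_form:
  assumes "transpose H = H" "transpose k0 ** H ** k0 = 0"
  obtains U where "H = U ** transpose w0 + w0 ** transpose U"
proof -
  define V where "V = sel X"
  have c: "k0 ** transpose (sel Y) = mat 1 - V ** transpose w0"
    unfolding V_def complement[symmetric] by simp
  have c': "sel Y ** transpose k0 = mat 1 - w0 ** transpose V"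
    using arg_cong[OF c, of transpose] by (simp add: transpose_simps)
  have "sel Y ** (transpose k0 ** H ** k0) ** transpose (sel Y) = 0"
    by (simp add: assms)
  then have "(mat 1 - w0 ** transpose V) ** H ** (mat 1 - V ** transpose w0) = 0"
    unfolding c[symmetric] c'[symmetric] by (simp add: matrix_mul_assoc)
  then have H: "H = w0 ** transpose V ** H + H ** V ** transpose w0
      - w0 ** (transpose V ** H ** V) ** transpose w0"
    by (simp add: mat_ring algebra_simps)
  \<comment> \<open>The doubly compressed term is shared equally between the two summands, which
    makes them transposes of each other.\<close>
  define T where "T = half (transpose V ** H ** V)"
  have T: "transpose T = T" "transpose V ** H ** V = T + T"
    by (simp_all add: T_def half_add transpose_half transpose_simps assms matrix_mul_assoc)
  define A where "A = w0 ** T ** transpose w0"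
  have "H = w0 ** transpose V ** H + H ** V ** transpose w0 - (A + A)"
    using H by (simp only: T(2) mat_ring A_def)
  also have "\<dots> = (H ** V ** transpose w0 - A) + (w0 ** transpose V ** H - A)"
    by (simp add: algebra_simps)
  also have "\<dots> = (H ** V - w0 ** T) ** transpose w0 + w0 ** transpose (H ** V - w0 ** T)"
    by (simp add: mat_ring transpose_simps assms T(1) A_def)
  finally have "H = (H ** V - w0 ** T) ** transpose w0 + w0 ** transpose (H ** V - w0 ** T)" .
  then show ?thesis by (rule that)
qed

type_synonym 's deform_param = "(complex ^ ('s \<times> coord) ^ ('s \<times> coord)) \<times> (complex ^ ('s \<times> coord) ^ ('s \<times> coord))
  \<times> (complex ^ 's ^ ('s \<times> coord)) \<times> (complex ^ ('s \<times> coord) ^ ('s \<times> coord)) \<times> (complex ^ 's ^ 's)"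

text \<open>The two antisymmetric parts make the derivative surjective onto all pairs of matrices;
  they vanish at parameters with symmetric image.\<close>

definition deform :: "'t deform_param \<Rightarrow> (complex ^ ('t \<times> coord) ^ ('t \<times> coord)) \<times> (complex ^ 't ^ 't)" where
  "deform z = (case z of (s, k, w, d, e) \<Rightarrow>
     (block_sym s + w ** N0 ** transpose w + (d - transpose d),
      transpose w ** block_sym k ** w + (e - transpose e)))"

definition deform' :: "'t deform_param \<Rightarrow> 't deform_param \<Rightarrow> (complex ^ ('t \<times> coord) ^ ('t \<times> coord)) \<times> (complex ^ 't ^ 't)" where
  "deform' z h = (case z of (s, k, w, d, e) \<Rightarrow> case h of (s', k', w', d', e') \<Rightarrow>
     (block_sym s' + (w ** N0 ** transpose w' + w' ** N0 ** transpose w) + (d' - transpose d'),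
      (transpose w ** block_sym k ** w' + (transpose w ** block_sym k' + transpose w' ** block_sym k) ** w)
        + (e' - transpose e')))"

lemma deform_has_derivative: "(deform has_derivative deform' z) (at z)"
proof -
  note mm = bounded_bilinear.FDERIV[OF matrix_bounded_bilinear]
  note tr = bounded_linear.has_derivative[OF transpose_bounded_linear]
  note bs = bounded_linear.has_derivative[OF block_sym_bounded_linear]
  let ?k = "\<lambda>z :: 't deform_param. fst (snd z)" and ?w = "\<lambda>z :: 't deform_param. fst (snd (snd z))"
    and ?d = "\<lambda>z :: 't deform_param. fst (snd (snd (snd z)))" and ?e = "\<lambda>z :: 't deform_param. snd (snd (snd (snd z)))"
  have s: "((fst :: 't deform_param \<Rightarrow> _) has_derivative fst) (at z)"
    and k: "(?k has_derivative ?k) (at z)" and w: "(?w has_derivative ?w) (at z)"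
    and d: "(?d has_derivative ?d) (at z)" and e: "(?e has_derivative ?e) (at z)"
    by (intro has_derivative_fst has_derivative_snd has_derivative_ident)+
  have wN: "((\<lambda>z. ?w z ** N0) has_derivative (\<lambda>h. ?w h ** N0)) (at z)"
    by (rule has_derivative_eq_rhs[OF mm[OF w has_derivative_const]]) simp
  \<comment> \<open>Patterns become projections, and \<open>deform'\<close> is grouped just as the
    product rule delivers it.\<close>
  have "deform = (\<lambda>z. (block_sym (fst z) + ?w z ** N0 ** transpose (?w z) + (?d z - transpose (?d z)),
      transpose (?w z) ** block_sym (?k z) ** ?w z + (?e z - transpose (?e z))))"
    by (simp add: fun_eq_iff deform_def)
  moreover have "deform' z = (\<lambda>h. (block_sym (fst h) + (?w z ** N0 ** transpose (?w h) + ?w h ** N0 ** transpose (?w z))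
      + (?d h - transpose (?d h)),
      (transpose (?w z) ** block_sym (?k z) ** ?w h + (transpose (?w z) ** block_sym (?k h)
        + transpose (?w h) ** block_sym (?k z)) ** ?w z) + (?e h - transpose (?e h))))"
    by (simp add: fun_eq_iff deform'_def split: prod.splits)
  ultimately show ?thesis
    by (simp only:) (intro has_derivative_Pair has_derivative_add has_derivative_diff mm tr bs s k w d e wN)
qed

text \<open>The inner factor \<open>transpose w ** k ** w\<close> is the inverse of
  \<open>N0\<close> and cancels it; cyclicity turns the trace into that of the identity of size
  5.\<close>

lemma factored_splitting:
  assumes "transpose w ** k ** w = S0"
  shows "(w ** N0 ** transpose w) ** k ** (w ** N0 ** transpose w) = w ** N0 ** transpose w"
    "trace (k ** (w ** N0 ** transpose w)) = 5"
proof -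
  have "(w ** N0 ** transpose w) ** k ** (w ** N0 ** transpose w) =
      w ** N0 ** (transpose w ** k ** w) ** N0 ** transpose w"
    by (simp add: matrix_mul_assoc)
  then show "(w ** N0 ** transpose w) ** k ** (w ** N0 ** transpose w) = w ** N0 ** transpose w"
    by (simp add: assms cancel)
  have "trace (k ** (w ** N0 ** transpose w)) = trace ((k ** w ** N0) ** transpose w)"
    by (simp add: matrix_mul_assoc)
  also have "\<dots> = trace (transpose w ** (k ** w ** N0))"
    by (rule trace_mul_commute)
  also have "\<dots> = trace (mat 1 :: complex ^ 't ^ 't)"
    by (simp add: matrix_mul_assoc assms S0_N0)
  also have "\<dots> = 5"
    by (simp add: trace_def mat_def card_UNIV)
  finally show "trace (k ** (w ** N0 ** transpose w)) = 5" .
qed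

text \<open>The open mapping theorem for \<open>deform\<close>: all pairs near
  \<open>(F0, S0)\<close> are values, and holding the second entry at \<open>S0\<close> gives the
  equation that \<open>factored_splitting\<close> asks for.\<close>

lemma near_F0:
  obtains e where "e > 0" "\<And>F. F \<in> sym_matrices \<Longrightarrow> dist F F0 < e \<Longrightarrow>
    \<exists>s k. block_diag s \<and> transpose s = s \<and> block_diag k \<and> transpose k = k \<and>
      (F - s) ** k ** (F - s) = F - s \<and> trace (k ** (F - s)) = 5"
proof -
  obtain B where B: "block_diag B" "transpose B = B" "transpose w0 ** B ** w0 = S0"
    using kappa_exists[OF transpose_S0] by blast
  \<comment> \<open>\<open>block_sym\<close> doubles a symmetric block diagonal matrix, hence the
    halves.\<close>
  define k where "k = half B"
  have kB: "block_sym k = B"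
    by (simp add: k_def block_sym_half B)
  define z0 :: "'t deform_param" where "z0 = (0, k, w0, 0, 0)"
  have "deform z0 = (F0, S0)"
    by (simp add: z0_def deform_def F0_def kB B transpose_0)
      (simp add: block_sym_def vec_eq_iff)
  \<comment> \<open>Solved in order: \<open>D\<close> matches \<open>H\<close> on the kernel of
    \<open>transpose w0\<close>, \<open>w'\<close> supplies the rest of \<open>H\<close>, and
    \<open>B'\<close> compensates the change \<open>J\<close> that \<open>w'\<close> causes in the
    second component. Antisymmetric parts are absorbed by the last two parameters.\<close>
  have ex: "\<exists>h. deform' z0 h = (H1, H2)" for H1 H2
  proof -
    define H where "H = half (H1 + transpose H1)"
    have H: "transpose H = H" "H1 = H + (half H1 - transpose (half H1))"
      unfolding H_def by (simp add: transpose_half transpose_simps add.commute) (rule sym_antisym_parts)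
    obtain D where D: "block_diag D" "transpose D = D" "transpose k0 ** D ** k0 = transpose k0 ** H ** k0"
      using shift_exists[of "transpose k0 ** H ** k0"] H(1) by (auto simp: transpose_simps matrix_mul_assoc)
    obtain U where U: "H - D = U ** transpose w0 + w0 ** transpose U"
      using transpose_w0_form[of "H - D"] D H(1) by (auto simp: transpose_simps mat_ring)
    \<comment> \<open>The factor \<open>S0\<close> cancels the \<open>N0\<close> in the
      derivative.\<close>
    define w' where "w' = U ** S0"
    have w': "w0 ** N0 ** transpose w' + w' ** N0 ** transpose w0 = H - D"
      unfolding U w'_def transpose_simps transpose_S0
      by (simp add: matrix_mul_assoc cancel add.commute)
    define J where "J = transpose w0 ** B ** w' + transpose w' ** B ** w0"
    have J: "transpose J = J"
      by (simp add: J_def transpose_simps B matrix_mul_assoc add.commute)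
    define H' where "H' = half (H2 + transpose H2)"
    have H': "transpose H' = H'" "H2 = H' + (half H2 - transpose (half H2))"
      unfolding H'_def by (simp add: transpose_half transpose_simps add.commute) (rule sym_antisym_parts)
    obtain B' where B': "block_diag B'" "transpose B' = B'" "transpose w0 ** B' ** w0 = H' - J"
      using kappa_exists[of "H' - J"] H'(1) J by (auto simp: transpose_simps)
    have "deform' z0 (half D, half B', w', half H1, half H2) = (H1, H2)"
      using H(2) H'(2) w' B'(3)
      by (simp add: deform'_def z0_def kB block_sym_half D B' mat_ring J_def)
    then show ?thesis by blast
  qed
  have surj: "surj (deform' z0)"
    unfolding surj_def
  proof
    fix y show "\<exists>x. y = deform' z0 x"
      using ex[of "fst y" "snd y"] unfolding prod.collapse by (elim exE) (rule exI, erule sym)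
  qed
  have "linear (deform' z0)"
    using deform_has_derivative has_derivative_linear by blast
  then obtain g where g: "linear g" "deform' z0 \<circ> g = id"
    using linear_surjective_right_inverse surj by blast
  have "continuous_on UNIV deform"
    using deform_has_derivative by (meson continuous_at_imp_continuous_on has_derivative_continuous)
  then have "deform z0 \<in> interior (range deform)"
    using sussmann_open_mapping[where S = UNIV and f = deform and x = z0 and f' = "deform' z0"
        and g' = g and T = UNIV] g deform_has_derivative
    by (simp add: linear_conv_bounded_linear)
  then obtain e where e: "e > 0" "ball (F0, S0) e \<subseteq> range deform"
    unfolding \<open>deform z0 = (F0, S0)\<close> mem_interior by blast
  show ?thesis
  proof (rule that[OF e(1)])
    fix F assume F: "F \<in> sym_matrices" "dist F F0 < e"
    then have "(F, S0) \<in> range deform"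
      by (intro subsetD[OF e(2)]) (simp add: dist_Pair_Pair dist_commute)
    then obtain s k w d e where eq: "F = block_sym s + w ** N0 ** transpose w + (d - transpose d)"
      "S0 = transpose w ** block_sym k ** w + (e - transpose e)"
      by (auto simp: deform_def)
    \<comment> \<open>Removes the auxiliary antisymmetric parameters, which transposition
      negates.\<close>
    have anti: "A - transpose A = 0" if "H = G + (A - transpose A)" "transpose H = H" "transpose G = G"
      for A G H :: "complex ^ 'n ^ 'n"
    proof -
      have "A - transpose A = - (A - transpose A)"
        using arg_cong[OF that(1), of transpose] that by (simp add: transpose_simps)
      then show ?thesis
        by (simp add: vec_eq_iff)
    qed
    define W where "W = w ** N0 ** transpose w"
    have d: "d - transpose d = 0"
      by (rule anti[OF eq(1)])
        (use F in \<open>simp_all add: sym_matrices_def transpose_simps transpose_block_sym transpose_N0 matrix_mul_assoc\<close>)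
    have e: "e - transpose e = 0"
      by (rule anti[OF eq(2)])
        (simp_all add: transpose_simps transpose_block_sym transpose_S0 matrix_mul_assoc)
    have FW: "F - block_sym s = W"
      using eq(1) d by (simp add: W_def)
    have S: "transpose w ** block_sym k ** w = S0"
      using eq(2) e by simp
    note 1 = factored_splitting[OF S, folded W_def]
    show "\<exists>s k. block_diag s \<and> transpose s = s \<and> block_diag k \<and> transpose k = k \<and>
        (F - s) ** k ** (F - s) = F - s \<and> trace (k ** (F - s)) = 5"
      using 1 FW block_diag_block_sym transpose_block_sym by metis
  qed
qed

end

section \<open>Operators and gauge transformations in coordinates\<close>

definition dpart :: "vu \<Rightarrow> complex ^ var" where
  "dpart v = (\<chi> p. v $ (fst p, D (snd p)))"

definition mpart :: "vu \<Rightarrow> complex ^ var" where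
  "mpart v = (\<chi> p. v $ (fst p, M (snd p)))"

lemma vu_eqI:
  assumes "dpart v = dpart w" "mpart v = mpart w"
  shows "v = w"
proof -
  have "v $ (t, a) = w $ (t, a)" for t a
    using arg_cong[OF assms(1), of "\<lambda>x. x $ (t, _)"] arg_cong[OF assms(2), of "\<lambda>x. x $ (t, _)"]
    by (cases a) (simp_all add: dpart_def mpart_def)
  then show ?thesis by (simp add: vec_eq_iff)
qed

lemma part_linear [simp]:
  "dpart (v + w) = dpart v + dpart w" "mpart (v + w) = mpart v + mpart w"
  "dpart (c *s v) = c *s dpart v" "mpart (c *s v) = c *s mpart v"
  "dpart 0 = 0" "mpart 0 = 0"
  by (simp_all add: dpart_def mpart_def vec_eq_iff)

lemma part_op [simp]:
  "dpart (form_op l) = 0" "mpart (form_op l) = l"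
  "dpart (derivation_op a) = a" "mpart (derivation_op a) = 0"
  "dpart (gaussian_op F p) = axis p 1" "mpart (gaussian_op F p) = F $ p"
  by (simp_all add: dpart_def mpart_def vec_eq_iff axis_def)

lemma part_sum [simp]:
  "dpart (sum f A) = (\<Sum>x\<in>A. dpart (f x))" "mpart (sum f A) = (\<Sum>x\<in>A. mpart (f x))"
  by (induction A rule: infinite_finite_induct) simp_all

text \<open>The derivative part of a combination of the spanning operators lists its coefficients,
  so their span is a graph.\<close>

lemma mem_V_L_iff: "v \<in> V_L F \<longleftrightarrow> mpart v = transpose F *v dpart v"
proof
  have "vec.subspace {v. mpart v = transpose F *v dpart v}"
    by (simp add: vec.subspace_def matrix_vector_right_distrib vector_scalar_commute del: transpose_matrix_vector)
  moreover have "range (gaussian_op F) \<subseteq> {v. mpart v = transpose F *v dpart v}"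
    by (auto simp: matrix_vector_mult_def transpose_def axis_def vec_eq_iff if_distrib[of "\<lambda>x. _ * x"]
        simp del: transpose_matrix_vector cong: if_cong)
  ultimately show "mpart v = transpose F *v dpart v" if "v \<in> V_L F"
    using vec.span_minimal that unfolding V_L_def by blast
next
  assume v: "mpart v = transpose F *v dpart v"
  have "v = (\<Sum>p\<in>UNIV. dpart v $ p *s gaussian_op F p)"
  proof (rule vu_eqI)
    show "dpart v = dpart (\<Sum>p\<in>UNIV. dpart v $ p *s gaussian_op F p)"
      by (simp add: basis_expansion)
    show "mpart v = mpart (\<Sum>p\<in>UNIV. dpart v $ p *s gaussian_op F p)"
      unfolding v by (simp add: matrix_vector_mult_def transpose_def vec_eq_iff mult.commute
          del: transpose_matrix_vector)
  qed
  moreover have "(\<Sum>p\<in>UNIV. dpart v $ p *s gaussian_op F p) \<in> V_L F"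
    unfolding V_L_def by (intro vec.span_sum vec.span_scale vec.span_base) auto
  ultimately show "v \<in> V_L F" by simp
qed

lemma mem_V_delta_iff:
  "v \<in> V_delta I l \<longleftrightarrow> mpart v \<in> vec.span (l ` I) \<and> (\<forall>i\<in>I. (\<Sum>p\<in>UNIV. dpart v $ p * l i $ p) = 0)"
proof
  let ?A = "{v. mpart v \<in> vec.span (l ` I) \<and> (\<forall>i\<in>I. (\<Sum>p\<in>UNIV. dpart v $ p * l i $ p) = 0)}"
  have "vec.subspace ?A"
    by (auto simp: vec.subspace_def vec.span_zero distrib_right sum.distrib vec.span_add vec.span_scale
        mult.assoc simp flip: sum_distrib_left)
  moreover have "form_op ` l ` I \<union> {derivation_op a | a. \<forall>i\<in>I. (\<Sum>p\<in>UNIV. a $ p * l i $ p) = 0} \<subseteq> ?A"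
    by (auto simp: vec.span_zero vec.span_base)
  ultimately show "mpart v \<in> vec.span (l ` I) \<and> (\<forall>i\<in>I. (\<Sum>p\<in>UNIV. dpart v $ p * l i $ p) = 0)"
    if "v \<in> V_delta I l"
    using vec.span_minimal that unfolding V_delta_def by blast
next
  assume v: "mpart v \<in> vec.span (l ` I) \<and> (\<forall>i\<in>I. (\<Sum>p\<in>UNIV. dpart v $ p * l i $ p) = 0)"
  have lin: "form_op (x + y) = form_op x + form_op y" "form_op (c *s x) = c *s form_op x" "form_op 0 = 0" for x y c
    by (rule vu_eqI; simp)+
  have "vec.subspace {m. form_op m \<in> V_delta I l}"
    by (simp add: vec.subspace_def lin V_delta_def vec.span_add vec.span_scale vec.span_zero)
  moreover have "l ` I \<subseteq> {m. form_op m \<in> V_delta I l}"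
    by (auto simp: V_delta_def intro: vec.span_base)
  ultimately have "form_op (mpart v) \<in> V_delta I l"
    using vec.span_minimal v by blast
  moreover have "derivation_op (dpart v) \<in> V_delta I l"
    unfolding V_delta_def using v by (intro vec.span_base) blast
  ultimately have "form_op (mpart v) + derivation_op (dpart v) \<in> V_delta I l"
    unfolding V_delta_def by (rule vec.span_add)
  moreover have "v = form_op (mpart v) + derivation_op (dpart v)"
    by (rule vu_eqI) simp_all
  ultimately show "v \<in> V_delta I l" by simp
qed

lemma sum_gen: "(\<Sum>a\<in>UNIV. f a) = (\<Sum>c\<in>UNIV. f (D c)) + (\<Sum>c\<in>UNIV. f (M c))"
proof -
  have "UNIV = range D \<union> range M" using gen.exhaust by blast
  then have "(\<Sum>a\<in>UNIV. f a) = sum f (range D \<union> range M)"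
    by (rule arg_cong)
  also have "\<dots> = sum f (range D) + sum f (range M)"
    by (rule sum.union_disjoint) auto
  finally show ?thesis
    by (simp add: sum.reindex inj_def)
qed

section \<open>Gauge transformations by shears\<close>

lemma Sp4_mul: "A \<in> Sp4 \<Longrightarrow> B \<in> Sp4 \<Longrightarrow> A ** B \<in> Sp4"
  by (simp add: Sp4_def flip: matrix_vector_mul_assoc)

lemma gauge_act_mul: "gauge_act (\<lambda>t. g t ** h t) v = gauge_act g (gauge_act h v)"
proof -
  have "component t (gauge_act h v) = h t *v component t v" for t
    by (simp add: component_def gauge_act_def vec_eq_iff)
  then show ?thesis
    by (simp add: gauge_act_def matrix_vector_mul_assoc)
qed

text \<open>On weights this is multiplication by a Gaussian in the variables of \<open>t\<close>;
  with a block diagonal \<open>s\<close> it replaces \<open>F\<close> by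
  \<open>F - s\<close>.\<close>

definition shear_M :: "complex ^ var ^ var \<Rightarrow> tetrahedron \<Rightarrow> complex ^ gen ^ gen" where
  "shear_M s t = (\<chi> a b. (if a = b then 1 else 0) -
     (case (a, b) of (M c, D d) \<Rightarrow> s $ (t, c) $ (t, d) | _ \<Rightarrow> 0))"

text \<open>The counterpart of \<open>shear_M\<close> with derivatives and multiplications
  exchanged, as under a Fourier transform.\<close>

definition shear_D :: "complex ^ var ^ var \<Rightarrow> tetrahedron \<Rightarrow> complex ^ gen ^ gen" where
  "shear_D k t = (\<chi> a b. (if a = b then 1 else 0) -
     (case (a, b) of (D c, M d) \<Rightarrow> k $ (t, c) $ (t, d) | _ \<Rightarrow> 0))"

lemma shear_mul:
  "(shear_M s t *v v) $ D c = v $ D c"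
  "(shear_M s t *v v) $ M c = v $ M c - (\<Sum>d\<in>UNIV. s $ (t, c) $ (t, d) * v $ D d)"
  "(shear_D k t *v v) $ D c = v $ D c - (\<Sum>d\<in>UNIV. k $ (t, c) $ (t, d) * v $ M d)"
  "(shear_D k t *v v) $ M c = v $ M c"
  by (cases c; simp add: matrix_vector_mult_def shear_M_def shear_D_def sum_gen sum_coord left_diff_distrib)+

lemma shear_Sp4:
  assumes "transpose s = s"
  shows "shear_M s t \<in> Sp4" "shear_D s t \<in> Sp4"
proof -
  have "s $ (t, Y) $ (t, X) = s $ (t, X) $ (t, Y)"
    using assms by (metis (no_types) transpose_def vec_lambda_beta)
  then show "shear_M s t \<in> Sp4" "shear_D s t \<in> Sp4"
    by (simp_all add: Sp4_def sympl_def shear_mul sum_coord algebra_simps)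
qed

lemma block_diag_mul_vec:
  assumes "block_diag A"
  shows "(A *v v) $ (t, c) = (\<Sum>d\<in>UNIV. A $ (t, c) $ (t, d) * v $ (t, d))"
proof -
  have "(A *v v) $ (t, c) = (\<Sum>t'\<in>UNIV. if t = t' then \<Sum>d\<in>UNIV. A $ (t, c) $ (t', d) * v $ (t', d) else 0)"
    unfolding matrix_vector_mult_def vec_lambda_beta sum_times
    using assms by (intro sum.cong refl) (auto simp: block_diag_def)
  then show ?thesis by simp
qed

lemma gauge_act_shear:
  assumes "block_diag s"
  shows "dpart (gauge_act (shear_M s) v) = dpart v"
    "mpart (gauge_act (shear_M s) v) = mpart v - s *v dpart v"
    "dpart (gauge_act (shear_D s) v) = dpart v - s *v mpart v"
    "mpart (gauge_act (shear_D s) v) = mpart v"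
  by (simp_all add: vec_eq_iff dpart_def mpart_def gauge_act_def shear_mul component_def
      block_diag_mul_vec[OF assms])

text \<open>The first shear yields the graph of \<open>G = F - s\<close>. As \<open>k ** G\<close>
  is idempotent, the second sends \<open>(d, G d)\<close> to \<open>(d - k G d, G d)\<close>, whose
  entries run independently through the kernel and the range of \<open>G\<close>. The forms are a
  basis of that range, of dimension \<open>trace (G ** k) = 5\<close>.\<close>

lemma reduce_to_delta:
  assumes F: "transpose F = F"
    and s: "block_diag s" "transpose s = s" and k: "block_diag k" "transpose k = k"
    and GkG: "(F - s) ** k ** (F - s) = F - s" and tr: "trace (k ** (F - s)) = 5"
  shows "\<exists>(g :: tetrahedron \<Rightarrow> complex ^ gen ^ gen) (l :: nat \<Rightarrow> complex ^ var).
        (\<forall>t. g t \<in> Sp4) \<and> inj_on l {1..5} \<and> vec.independent (l ` {1..5}) \<and>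
        gauge_act g ` V_L F = V_delta {1..5} l"
proof -
  define G where "G = F - s"
  have G: "G ** k ** G = G" "transpose G = G"
    using GkG F s by (simp_all add: G_def transpose_simps)
  have Gv: "G *v (k *v (G *v x)) = G *v x" for x
    using arg_cong[OF G(1), of "\<lambda>A. A *v x"]
    by (simp add: matrix_vector_mul_assoc matrix_mul_assoc)
  have "(G ** k) ** (G ** k) = G ** k"
    by (simp add: matrix_mul_assoc G)
  then obtain B where B: "vec.independent B" "vec.span B = range ((*v) (G ** k))"
    "trace (G ** k) = of_nat (card B)"
    by (rule trace_idempotent)
  have "range ((*v) (G ** k)) = range ((*v) G)"
    using Gv by (auto simp: image_iff simp flip: matrix_vector_mul_assoc) metis
  with B(2) have span: "vec.span B = range ((*v) G)" by simp
  have "card B = 5"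
    using B(3) tr by (simp add: G_def trace_mul_commute[of "F - s"]) (metis of_nat_eq_iff of_nat_numeral)
  moreover have "finite B"
    by (rule vec.finiteI_independent[OF B(1)])
  ultimately obtain l where "bij_betw l {1..5::nat} B"
    using ex_bij_betw_nat_finite_1 by metis
  then have l: "inj_on l {1..5}" "l ` {1..5} = B"
    by (auto simp: bij_betw_def)
  have adjoint: "(\<Sum>p\<in>UNIV. a $ p * (G *v u) $ p) = (\<Sum>p\<in>UNIV. (G *v a) $ p * u $ p)" for a u
  proof -
    have "(\<Sum>p\<in>UNIV. a $ p * (G *v u) $ p) = (\<Sum>p\<in>UNIV. \<Sum>q\<in>UNIV. a $ p * G $ p $ q * u $ q)"
      by (simp add: matrix_vector_mult_def sum_distrib_left mult.assoc)
    also have "\<dots> = (\<Sum>q\<in>UNIV. \<Sum>p\<in>UNIV. a $ p * transpose G $ q $ p * u $ q)"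
      by (subst sum.swap) (simp add: transpose_def)
    also have "\<dots> = (\<Sum>p\<in>UNIV. (G *v a) $ p * u $ p)"
      by (simp add: G matrix_vector_mult_def sum_distrib_left mult_ac)
    finally show ?thesis .
  qed
  \<comment> \<open>\<open>G\<close> is symmetric, so the vectors orthogonal to its range form its
    kernel.\<close>
  have ortho: "(\<forall>i\<in>{1..5}. (\<Sum>p\<in>UNIV. a $ p * l i $ p) = 0) \<longleftrightarrow> G *v a = 0" for a
  proof
    assume z: "\<forall>i\<in>{1..5}. (\<Sum>p\<in>UNIV. a $ p * l i $ p) = 0"
    have "vec.subspace {x. (\<Sum>p\<in>UNIV. a $ p * x $ p) = 0}"
      by (auto simp: vec.subspace_def distrib_left sum.distrib mult.left_commute simp flip: sum_distrib_left)
    moreover have "B \<subseteq> {x. (\<Sum>p\<in>UNIV. a $ p * x $ p) = 0}"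
      using z l(2) by auto
    ultimately have "range ((*v) G) \<subseteq> {x. (\<Sum>p\<in>UNIV. a $ p * x $ p) = 0}"
      unfolding span[symmetric] by (rule vec.span_minimal[rotated])
    then have "(\<Sum>p\<in>UNIV. a $ p * (G *v u) $ p) = 0" for u
      by blast
    from trans[OF adjoint[symmetric] this] have "(\<Sum>p\<in>UNIV. (G *v a) $ p * u $ p) = 0" for u .
    from this[of "axis _ 1"] show "G *v a = 0"
      by (simp add: vec_eq_iff axis_def if_distrib[of "\<lambda>x. _ * x"] cong: if_cong)
  next
    assume a: "G *v a = 0"
    show "\<forall>i\<in>{1..5}. (\<Sum>p\<in>UNIV. a $ p * l i $ p) = 0"
    proof
      fix i :: nat assume "i \<in> {1..5}"
      then have "l i \<in> range ((*v) G)"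
        unfolding span[symmetric] l(2)[symmetric] by (intro vec.span_base imageI)
      then obtain u where "l i = G *v u" by auto
      then show "(\<Sum>p\<in>UNIV. a $ p * l i $ p) = 0"
        using adjoint[of a u] by (simp add: a)
    qed
  qed
  define g where "g = (\<lambda>t. shear_D k t ** shear_M s t)"
  have g: "dpart (gauge_act g v) = dpart v - k *v (mpart v - s *v dpart v)"
    "mpart (gauge_act g v) = mpart v - s *v dpart v" for v
    by (simp_all add: g_def gauge_act_mul gauge_act_shear s k)
  have FG: "F *v x = s *v x + G *v x" for x
    by (simp add: G_def matrix_vector_mult_diff_rdistrib)
  have mem_L: "v \<in> V_L F \<longleftrightarrow> mpart v = F *v dpart v" for v
    by (metis mem_V_L_iff F)
  have mem_d: "v \<in> V_delta {1..5} l \<longleftrightarrow> mpart v \<in> range ((*v) G) \<and> G *v dpart v = 0" for v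
    unfolding mem_V_delta_iff ortho l(2) span ..
  have "gauge_act g ` V_L F = V_delta {1..5} l"
  proof (intro subset_antisym subsetI)
    fix v' assume "v' \<in> gauge_act g ` V_L F"
    then obtain v where v: "mpart v = F *v dpart v" "v' = gauge_act g v"
      by (auto simp: mem_L)
    then have "mpart v' = G *v dpart v" "dpart v' = dpart v - k *v (G *v dpart v)"
      by (simp_all add: g FG)
    then show "v' \<in> V_delta {1..5} l"
      unfolding mem_d by (simp add: matrix_vector_mult_diff_distrib Gv)
  next
    fix v' assume "v' \<in> V_delta {1..5} l"
    then obtain u where u: "mpart v' = G *v u" and d: "G *v dpart v' = 0"
      unfolding mem_d by auto
    \<comment> \<open>\<open>a\<close> undoes the second shear, \<open>s *v a + mpart v'\<close> the
      first.\<close>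
    define a where "a = dpart v' + k *v mpart v'"
    define v where "v = form_op (s *v a + mpart v') + derivation_op a"
    have v: "dpart v = a" "mpart v = s *v a + mpart v'"
      by (simp_all add: v_def)
    have "G *v a = mpart v'"
      by (simp add: a_def matrix_vector_right_distrib d u Gv)
    then have "v \<in> V_L F"
      by (simp add: mem_L v FG)
    moreover have "v' = gauge_act g v"
      by (rule vu_eqI) (simp_all add: g v, simp add: a_def)
    ultimately show "v' \<in> gauge_act g ` V_L F" by blast
  qed
  moreover have "g t \<in> Sp4" for t
    by (simp add: g_def Sp4_mul shear_Sp4 s k)
  ultimately show ?thesis
    using l B(1) by blast
qed

section \<open>From stabilizer elements to splittings\<close>

text \<open>With \<open>J = (\<alpha>, \<beta>; \<gamma>, -\<alpha>\<^sup>T)\<close>: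
  \<open>J\<close> preserves the Lagrangian subspace, the upper row of blocks of
  \<open>J\<^sup>2\<close> is that of the scalar \<open>c\<close>, and \<open>J\<close> has trace 0
  on the subspace, where it acts on derivative parts by \<open>\<alpha> + \<beta> F\<close>.\<close>

definition normalized :: "complex ^ ('t::finite \<times> coord) ^ ('t \<times> coord) \<Rightarrow> complex ^ 't gauge_index \<Rightarrow> complex \<Rightarrow> bool" where
  "normalized F x c \<longleftrightarrow> stab F x = 0 \<and> alpha_block x ** alpha_block x + beta_block x ** gamma_block x = mat c \<and>
     alpha_block x ** beta_block x = beta_block x ** transpose (alpha_block x) \<and> trace (alpha_block x + beta_block x ** F) = 0"

lemma mat_mat: "mat a ** mat b = (mat (a * b) :: 'a::semiring_1 ^ 'n ^ 'n)"
  by (simp add: vec_eq_iff mat_def matrix_matrix_mult_def if_distrib[of "\<lambda>x. x * _"] cong: if_cong)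

lemma trace_mat_mul: "trace (mat c ** A) = c * trace (A :: 'a::comm_semiring_1 ^ 'n ^ 'n)"
  by (simp add: trace_def mat_mul_nth sum_distrib_left)

lemma normalized_scale:
  assumes "normalized F x c"
  shows "normalized F (m *s x) (m\<^sup>2 * c)"
proof -
  have sq: "(mat m ** A) ** (mat m ** B) = mat (m\<^sup>2) ** (A ** B)"
    for A B :: "complex ^ ('a \<times> coord) ^ ('a \<times> coord)"
  proof -
    have "(mat m ** A) ** (mat m ** B) = mat m ** (A ** mat m) ** B"
      by (simp add: matrix_mul_assoc)
    also have "\<dots> = (mat m ** mat m) ** (A ** B)"
      unfolding mat_commute[of A] by (simp add: matrix_mul_assoc)
    finally show ?thesis by (simp add: mat_mat power2_eq_square)
  qed
  have tr: "transpose (mat m ** A) = mat m ** transpose A"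
    for A :: "complex ^ ('a \<times> coord) ^ ('a \<times> coord)"
    by (simp add: transpose_simps mat_commute)
  have "alpha_block (m *s x) + beta_block (m *s x) ** F = mat m ** (alpha_block x + beta_block x ** F)"
    by (simp add: gauge_scale mat_ring)
  then show ?thesis
    using assms
    by (simp add: normalized_def stab_scale trace_mat_mul)
      (simp add: gauge_scale sq tr mat_mat flip: matrix_add_ldistrib)
qed

context pentagon
begin

lemma trace_mat_1: "trace (mat 1 :: complex ^ ('t \<times> coord) ^ ('t \<times> coord)) = 10"
proof -
  have "CARD(coord) = 2" by (simp add: UNIV_coord)
  then show ?thesis by (simp add: trace_def mat_def card_UNIV)
qed

lemma splitting_imp_normalized:
  fixes F s k :: "complex ^ ('t \<times> coord) ^ ('t \<times> coord)"
  assumes s: "block_diag s" "transpose s = s" and k: "block_diag k" "transpose k = k"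
    and G: "(F - s) ** k ** (F - s) = F - s" and tr: "trace (k ** (F - s)) = 5"
  obtains x where "normalized F x 1" "beta_block x = k + k"
proof -
  \<comment> \<open>After the two shears of \<open>reduce_to_delta\<close>, \<open>J\<close> is
    \<open>-1\<close> on derivatives and \<open>1\<close> on multiplications; conjugating back
    through them gives these blocks.\<close>
  define a b c where "a = - mat 1 - (k ** s + k ** s)" and "b = k + k"
    and "c = - (s + s) - (s ** k ** s + s ** k ** s)"
  have "block_diag a" "block_diag b" "block_diag c"
    unfolding a_def b_def c_def
    by (intro block_diag_add block_diag_diff block_diag_minus block_diag_mul block_diag_mat s k)+
  moreover have "transpose b = b" "transpose c = c"
    by (simp_all only: b_def c_def transpose_simps s k matrix_mul_assoc)
  ultimately obtain x where x: "alpha_block x = a" "beta_block x = b" "gamma_block x = c"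
    by (rule gauge_exists)
  have ta: "transpose a = - mat 1 - (s ** k + s ** k)"
    by (simp only: a_def transpose_simps transpose_mat s k)
  have FkF: "F ** k ** F = F ** k ** s + s ** k ** F - s ** k ** s + F - s"
    using G by (simp only: mat_ring) (simp add: algebra_simps)
  have "stab F x = 0"
    unfolding stab_def x ta
    by (simp only: a_def b_def c_def mat_ring FkF matrix_mul_lid matrix_mul_rid) simp
  moreover have "a ** a + b ** c = mat 1"
    by (simp only: a_def b_def c_def mat_ring matrix_mul_lid matrix_mul_rid) simp
  moreover have "a ** b = b ** transpose a"
    unfolding ta
    by (simp only: a_def b_def mat_ring matrix_mul_lid matrix_mul_rid) (simp add: algebra_simps)
  moreover have "trace (a + b ** F) = 0"
  proof -
    have "a + b ** F = - mat 1 + (k ** (F - s) + k ** (F - s))"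
      by (simp only: a_def b_def mat_ring) simp
    moreover have "trace (- mat 1 + (k ** (F - s) + k ** (F - s))) = - trace (mat 1 :: complex ^ ('t \<times> coord) ^ ('t \<times> coord))
        + (trace (k ** (F - s)) + trace (k ** (F - s)))"
      by (simp only: trace_def vector_add_component vector_uminus_component sum.distrib sum_negf)
    ultimately show ?thesis by (simp add: tr trace_mat_1)
  qed
  ultimately show ?thesis
    by (intro that[of x]) (simp_all add: normalized_def x b_def)
qed

text \<open>Inverts the formulas of \<open>splitting_imp_normalized\<close>:
  \<open>\<beta> = 2 k\<close> and \<open>\<alpha> = - 1 - \<beta> s\<close> determine
  \<open>k\<close> and, for invertible \<open>\<beta>\<close>, also \<open>s\<close>. Symmetry of
  \<open>s\<close> comes from \<open>\<alpha> \<beta> = \<beta> \<alpha>\<^sup>T\<close>, and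
  stability becomes \<open>G \<beta> G = 2 G\<close>.\<close>

lemma normalized_imp_splitting:
  fixes F :: "complex ^ ('t \<times> coord) ^ ('t \<times> coord)"
  assumes x: "normalized F x 1" and inv: "det (beta_block x) \<noteq> 0"
  obtains s k where "block_diag s" "transpose s = s" "block_diag k" "transpose k = k"
    "(F - s) ** k ** (F - s) = F - s" "trace (k ** (F - s)) = 5"
proof -
  define a b c where "a = alpha_block x" and "b = beta_block x" and "c = gamma_block x"
  have st: "F ** b ** F + F ** a + transpose a ** F = c" and sq: "a ** a + b ** c = mat 1"
    and ab: "a ** b = b ** transpose a" and tr: "trace (a + b ** F) = 0"
    using x by (simp_all add: normalized_def a_def b_def c_def stab_def)
  obtain i where bi: "b ** i = mat 1" and ib: "i ** b = mat 1"
    using inv invertible_det_nz[of b] unfolding invertible_def b_def by blast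
  have tb: "transpose b = b"
    by (simp add: b_def sym_gauge)
  have "block_diag i"
    by (rule block_diag_inverse[OF _ bi ib]) (simp add: b_def block_diag_gauge)
  have "transpose i ** b = mat 1"
    using arg_cong[OF bi, of transpose] by (simp add: transpose_simps tb)
  then have "transpose i ** b ** i = i" by simp
  then have ti: "transpose i = i"
    by (simp add: bi flip: matrix_mul_assoc)
  have "i ** (a ** b) ** i = i ** (b ** transpose a) ** i"
    by (simp add: ab)
  then have ia: "transpose a ** i = i ** a"
    by (simp add: matrix_mul_assoc ib) (simp add: bi flip: matrix_mul_assoc)
  define s where "s = - i - i ** a"
  have s: "block_diag s" "transpose s = s"
    unfolding s_def a_def
    by (intro block_diag_diff block_diag_minus block_diag_mul block_diag_gauge \<open>block_diag i\<close>)
      (simp add: transpose_simps ti ia[unfolded a_def])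
  have bs: "b ** s = - mat 1 - a"
    by (simp add: s_def mat_ring bi)
  have sb: "s ** b = - mat 1 - transpose a"
    using arg_cong[OF bs, of transpose] by (simp add: transpose_simps tb s)
  have "i ** (b ** c) = i ** (mat 1 - a ** a)"
    unfolding sq[symmetric] by simp
  then have c: "c = i - i ** a ** a"
    by (simp add: mat_ring ib)
  have sbs: "s ** b ** s = i + i ** a + i ** a + i ** a ** a"
    unfolding sb by (simp only: s_def mat_ring matrix_mul_lid) (simp add: ia)
  have FbF: "F ** b ** F = c - F ** a - transpose a ** F"
    using st by (simp add: algebra_simps)
  define G where "G = F - s"
  have Fbs: "F ** b ** s = - F - F ** a"
    using arg_cong[OF bs, of "\<lambda>A. F ** A"] by (simp add: mat_ring)
  have "G ** b ** G = F ** b ** F - s ** b ** F - F ** b ** s + s ** b ** s"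
    by (simp only: G_def mat_ring) (simp add: algebra_simps)
  also have "\<dots> = G + G"
    unfolding FbF Fbs sbs sb c G_def
    by (simp only: mat_ring matrix_mul_lid s_def) (simp add: ia algebra_simps)
  finally have GbG: "G ** b ** G = G + G" .
  define k where "k = half b"
  have k: "block_diag k" "transpose k = k"
    by (simp_all add: k_def half_def block_diag_mul block_diag_mat block_diag_gauge b_def)
      (simp add: transpose_half[unfolded half_def] sym_gauge)
  have "G ** k ** G = half (G ** b ** G)"
    unfolding k_def half_def matrix_mul_assoc mat_commute[of G] ..
  also have "\<dots> = G"
    by (simp only: GbG half_def matrix_add_ldistrib half_add[unfolded half_def])
  finally have GkG: "G ** k ** G = G" .
  have "b ** G = a + b ** F + mat 1"
    by (simp add: G_def matrix_diff_ldistrib bs)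
  then have "trace (b ** G) = trace (a + b ** F) + trace (mat 1 :: complex ^ ('t \<times> coord) ^ ('t \<times> coord))"
    by (simp only: trace_def vector_add_component sum.distrib)
  then have "trace (b ** G) = 10"
    by (simp only: tr trace_mat_1) simp
  then have "trace (k ** G) = 5"
    by (simp add: k_def half_def trace_mat_mul flip: matrix_mul_assoc)
  then show ?thesis
    using that s k GkG unfolding G_def by blast
qed

lemma normalized_F0:
  obtains x where "normalized F0 x 1" "det (beta_block x) \<noteq> 0"
proof -
  \<comment> \<open>With \<open>1 / 2\<close> off the diagonal, \<open>w0\<close> compresses
    \<open>k\<close> to \<open>S / 2 + S / 2\<close>, while \<open>k + k\<close> exchanges
    \<open>X\<close> and \<open>Y\<close> in each block and so is its own inverse.\<close>
  obtain k :: "complex ^ ('t \<times> coord) ^ ('t \<times> coord)" where k: "block_diag k" "transpose k = k"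
    "\<And>t. k $ (t, X) $ (t, X) = 0" "\<And>t. k $ (t, X) $ (t, Y) = 1 / 2" "\<And>t. k $ (t, Y) $ (t, Y) = 0"
    using sym_blocks[of "\<lambda>_. 0" "\<lambda>_. 1 / 2" "\<lambda>_. 0"] by blast
  have k': "k $ (t, Y) $ (t, X) = 1 / 2" for t
    using k(2,4) by (metis transpose_nth)
  have "transpose w0 ** k ** w0 = S0"
    unfolding vec_eq_iff w0_form[OF k(1,2)] k by (simp add: adj_form_def S0_def)
  note split = factored_splitting[OF this, folded F0_def]
  obtain x where x: "normalized F0 x 1" "beta_block x = k + k"
    by (rule splitting_imp_normalized[of 0 k F0]) (simp_all add: k split transpose_0 block_diag_def[of 0])
  have "(k + k) ** (k + k) = mat 1"
  proof (rule block_diag_eqI[OF block_diag_mul block_diag_mat])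
    show kk: "block_diag (k + k)" "block_diag (k + k)"
      by (intro block_diag_add k)+
    fix t c d
    have "((k + k) ** (k + k)) $ (t, c) $ (t, d) = ((k + k) *v column (t, d) (k + k)) $ (t, c)"
      by (simp add: matrix_matrix_mult_def matrix_vector_mult_def column_def)
    also have "\<dots> = mat 1 $ (t, c) $ (t, d)"
      unfolding block_diag_mul_vec[OF kk(1)]
      by (cases c; cases d) (simp_all add: sum_coord column_def k k' mat_def)
    finally show "((k + k) ** (k + k)) $ (t, c) $ (t, d) = mat 1 $ (t, c) $ (t, d)" .
  qed
  then have "det (k + k) \<noteq> 0"
    using invertible_det_nz[of "k + k"] unfolding invertible_def by blast
  with x that show ?thesis by simp
qed

end

section \<open>The open set and the conclusion\<close>

theorem mainTheorem5:
  "\<exists>U :: (complex ^ var ^ var) set. zariski_open_sym U \<and> U \<noteq> {} \<and>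
     (\<forall>F\<in>U. \<exists>(g :: tetrahedron \<Rightarrow> complex ^ gen ^ gen) (l :: nat \<Rightarrow> complex ^ var).
        (\<forall>t. g t \<in> Sp4) \<and>
        inj_on l {1..5} \<and> vec.independent (l ` {1..5}) \<and>
        gauge_act g ` V_L F = V_delta {1..5} l)"
proof -
  obtain \<sigma> :: "tetrahedron \<Rightarrow> tetrahedron" where \<sigma>: "pentagon \<sigma>"
    using tetrahedron_cycle by (metis pentagon.intro)
  interpret pentagon \<sigma> by (rule \<sigma>)
  define t0 :: tetrahedron where "t0 = undefined"
  \<comment> \<open>At \<open>F0\<close> this coordinate vanishes only on the zero solution, by
    \<open>stab_F0_kernel\<close>, so it can normalise the line of solutions.\<close>
  define i0 :: "tetrahedron gauge_index" where "i0 = (t0, Inl (X, X))"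
  have F0: "F0 \<in> sym_matrices"
    by (simp add: sym_matrices_def transpose_F0)
  have sys: "stab_system i0 F *v x = x $ i0 *s axis None 1" if "stab F x = 0" for F x
    by (simp add: vec_eq_iff stab_system_mul axis_def that split: option.split)
  have inj: "x = 0" if "stab_system i0 F0 *v x = 0" for x
  proof (rule stab_F0_kernel)
    have e: "(case e of None \<Rightarrow> x $ i0 | Some (p, q) \<Rightarrow> stab F0 x $ p $ q) = 0" for e
      using that by (simp add: stab_system_mul[symmetric])
    show "stab F0 x = 0"
      using e[of "Some _"] by (auto simp: vec_eq_iff split: prod.splits)
    show "x $ (t0, Inl (X, X)) = 0"
      using e[of None] by (simp add: i0_def)
  qed
  have "\<exists>\<xi> \<delta>. (\<forall>i. (\<lambda>F. \<xi> F $ i) \<in> mpolys) \<and> \<delta> \<in> mpolys \<and> \<delta> F0 \<noteq> 0 \<and>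
      (\<forall>F x c. stab_system i0 F *v x = c *s axis None 1 \<longrightarrow> \<delta> F *s x = c *s \<xi> F)"
    by (rule generic_cramer[where b = "axis None 1", OF poly_funs_stab_system inj], assumption) blast
  then obtain \<xi> \<delta> where \<xi>: "\<And>i. (\<lambda>F. \<xi> F $ i) \<in> mpolys" and \<delta>: "\<delta> \<in> mpolys" "\<delta> F0 \<noteq> 0"
    and cramer: "\<And>F x c. stab_system i0 F *v x = c *s axis None 1 \<Longrightarrow> \<delta> F *s x = c *s \<xi> F"
    by blast
  \<comment> \<open>\<open>J\<^sup>2 = 1\<close> excludes \<open>x = 0\<close>; Cramer's identity
    then forces \<open>x $ i0 \<noteq> 0\<close> and makes \<open>\<xi> F\<close> proportional to
    \<open>x\<close>.\<close>
  have \<xi>_multiple: "\<exists>m. m \<noteq> 0 \<and> \<xi> F = m *s x" if "normalized F x 1" "\<delta> F \<noteq> 0" for F x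
  proof -
    have eq: "\<delta> F *s x = x $ i0 *s \<xi> F"
      using that(1) by (intro cramer sys) (simp add: normalized_def)
    have "x \<noteq> 0"
    proof
      assume "x = 0"
      then have "alpha_block x = 0" "beta_block x = 0"
        by (simp_all add: alpha_block_def beta_block_def vec_eq_iff)
      then have "(mat 1 :: complex ^ var ^ var) = 0"
        using that(1) by (simp add: normalized_def)
      from arg_cong[OF this, of "\<lambda>A. A $ (t0, X) $ (t0, X)"] show False
        by (simp add: mat_def)
    qed
    then have "x $ i0 \<noteq> 0"
      using eq that(2) by auto
    moreover have "\<xi> F = (\<delta> F / x $ i0) *s x"
    proof -
      have "x $ i0 * \<xi> F $ i = \<delta> F * x $ i" for i
        using arg_cong[OF eq, of "\<lambda>v. v $ i"] by simp
      then show ?thesis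
        using \<open>x $ i0 \<noteq> 0\<close> by (simp add: vec_eq_iff field_simps)
    qed
    ultimately show ?thesis
      using that(2) by (intro exI[of _ "\<delta> F / x $ i0"]) simp
  qed
  \<comment> \<open>Reading the scalar off one diagonal entry makes it a polynomial in
    \<open>F\<close>, defined everywhere.\<close>
  define c where "c F = (alpha_block (\<xi> F) ** alpha_block (\<xi> F) + beta_block (\<xi> F) ** gamma_block (\<xi> F)) $ (t0, X) $ (t0, X)" for F
  have normalized_c: "normalized F (\<xi> F) (c F)" "c F \<noteq> 0" if x: "normalized F x 1" and d: "\<delta> F \<noteq> 0" for F x
  proof -
    obtain m where m: "m \<noteq> 0" "\<xi> F = m *s x"
      using \<xi>_multiple[OF x d] by blast
    have n: "normalized F (\<xi> F) (m\<^sup>2)"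
      using normalized_scale[OF x, of m] by (simp add: m(2))
    then have "c F = m\<^sup>2"
      by (simp add: c_def normalized_def mat_def)
    with n m show "normalized F (\<xi> F) (c F)" "c F \<noteq> 0"
      by simp_all
  qed
  define h where "h F = c F * det (beta_block (\<xi> F))" for F
  note poly = poly_funs.add poly_funs_diff poly_funs_uminus poly_funs_matrix_mul poly_funs_gauge[OF \<xi>]
    mpolys_coord poly_funs_sum finite poly_funs_det poly_funs_stab[OF \<xi>]
  have c_poly: "c \<in> mpolys"
    unfolding c_def vector_add_component by (intro poly)
  have tr_poly: "(\<lambda>F. transpose (alpha_block (\<xi> F)) $ p $ q) \<in> mpolys" for p q
    unfolding transpose_nth by (intro poly)
  have mat_poly: "(\<lambda>F. mat (c F) $ p $ q) \<in> mpolys" for p q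
    unfolding mat_def vec_lambda_beta by (intro poly_funs_if c_poly poly_funs.const)
  obtain e where e: "e > 0" and near: "\<And>F. F \<in> sym_matrices \<Longrightarrow> dist F F0 < e \<Longrightarrow> \<exists>x. normalized F x 1"
    using near_F0 splitting_imp_normalized by metis
  \<comment> \<open>The product with \<open>\<delta>\<close> vanishes on a full neighbourhood of
    \<open>F0\<close>, including the points where \<open>\<delta>\<close> is zero and
    \<open>\<xi>\<close> is not controlled.\<close>
  have identity: "Q F = 0" if Q: "Q \<in> mpolys" and F: "F \<in> sym_matrices" "\<delta> F \<noteq> 0"
    and zero: "\<And>F. normalized F (\<xi> F) (c F) \<Longrightarrow> Q F = 0" for Q F
  proof -
    have "(\<lambda>F. \<delta> F * Q F) F = 0"
    proof (rule mpolys_identity[OF poly_funs.mult[OF \<delta>(1) Q] e F0 _ F(1)])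
      fix F assume "F \<in> sym_matrices" "dist F F0 < e"
      then show "\<delta> F * Q F = 0"
        using near normalized_c(1) zero by (metis mult_eq_0_iff)
    qed
    with F(2) show ?thesis by simp
  qed
  have normalized: "normalized F (\<xi> F) (c F)" if F: "F \<in> sym_matrices" "\<delta> F \<noteq> 0" for F
  proof -
    note id = identity[OF _ F]
    have "stab F (\<xi> F) $ p $ q = 0" for p q
      by (rule id) (auto intro: poly simp: normalized_def)
    moreover have "(alpha_block (\<xi> F) ** alpha_block (\<xi> F) + beta_block (\<xi> F) ** gamma_block (\<xi> F) - mat (c F)) $ p $ q = 0" for p q
      by (rule id, unfold vector_add_component vector_minus_component, intro poly mat_poly)
        (simp add: normalized_def flip: vector_add_component)
    moreover have "(alpha_block (\<xi> F) ** beta_block (\<xi> F) - beta_block (\<xi> F) ** transpose (alpha_block (\<xi> F))) $ p $ q = 0" for p q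
      by (rule id, unfold vector_minus_component, intro poly tr_poly) (simp add: normalized_def)
    moreover have "trace (alpha_block (\<xi> F) + beta_block (\<xi> F) ** F) = 0"
      by (rule id, unfold trace_def vector_add_component, intro poly)
        (simp add: normalized_def trace_def flip: vector_add_component)
    ultimately show ?thesis
      unfolding normalized_def by (simp add: vec_eq_iff)
  qed
  \<comment> \<open>The three factors ensure in turn that the identities hold, that
    \<open>\<xi> F\<close> can be scaled to square 1, and that its \<open>\<beta>\<close> is
    invertible.\<close>
  define P where "P F = \<delta> F * h F" for F
  define U where "U = sym_matrices - {F. P F = 0}"
  have "P \<in> mpolys"
    unfolding P_def h_def by (intro poly_funs.mult \<delta> c_poly poly)
  then have "zariski_open_sym U"
    unfolding zariski_open_sym_def U_def by (intro exI[of _ "{P}"]) auto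
  moreover have "F0 \<in> U"
  proof -
    obtain x where x: "normalized F0 x 1" "det (beta_block x) \<noteq> 0"
      by (rule normalized_F0)
    obtain m where m: "m \<noteq> 0" "\<xi> F0 = m *s x"
      using \<xi>_multiple[OF x(1) \<delta>(2)] by blast
    have "beta_block (\<xi> F0) = mat m ** beta_block x"
      by (simp add: m gauge_scale)
    then have "det (beta_block (\<xi> F0)) \<noteq> 0"
      using x(2) m(1) by (simp add: det_mul det_diagonal mat_def)
    then show ?thesis
      using F0 \<delta>(2) normalized_c(2)[OF x(1) \<delta>(2)] by (simp add: U_def P_def h_def)
  qed
  moreover have "\<exists>(g :: tetrahedron \<Rightarrow> complex ^ gen ^ gen) (l :: nat \<Rightarrow> complex ^ var).
        (\<forall>t. g t \<in> Sp4) \<and> inj_on l {1..5} \<and> vec.independent (l ` {1..5}) \<and>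
        gauge_act g ` V_L F = V_delta {1..5} l" if F: "F \<in> U" for F
  proof -
    have sym: "F \<in> sym_matrices" and nz: "\<delta> F \<noteq> 0" "c F \<noteq> 0" "det (beta_block (\<xi> F)) \<noteq> 0"
      using F by (auto simp: U_def P_def h_def)
    \<comment> \<open>Scaling by \<open>m\<close> changes the square by \<open>m\<^sup>2\<close>,
      hence the root.\<close>
    define m where "m = 1 / csqrt (c F)"
    have m: "m \<noteq> 0" "m\<^sup>2 * c F = 1"
      using nz(2) by (simp_all add: m_def power_divide)
    have "normalized F (m *s \<xi> F) 1"
      using normalized_scale[OF normalized[OF sym nz(1)], of m] m(2) by simp
    moreover have "det (beta_block (m *s \<xi> F)) \<noteq> 0"
      using nz(3) m(1) by (simp add: gauge_scale det_mul det_diagonal mat_def)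
    ultimately obtain s k where "block_diag s" "transpose s = s" "block_diag k" "transpose k = k"
      "(F - s) ** k ** (F - s) = F - s" "trace (k ** (F - s)) = 5"
      by (rule normalized_imp_splitting)
    with sym show ?thesis
      by (intro reduce_to_delta) (simp_all add: sym_matrices_def)
  qed
  ultimately show ?thesis by blast
qed

end
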